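(* Let $f:\mathbb R^d\to\mathbb R$ be convex with at least one minimizer $x^*$, and three times continuously differentiable with $\|\nabla^3f(x)-\nabla^3f(y)\|\le L_3\|x-y\|$ for all $x,y\in\mathbb R^d$, where $L_3>0$. Let $H$ be a $\delta$-Hessian estimator: $H(x)=H(x)^\top$ and $\|H(x)-\nabla^2f(x)\|\le\delta$ for all $x\in\mathbb R^d$. Let $R(x_0)=\sup\{\|y-x^*\|:y\in\mathbb R^d,\ f(y)\le f(x_0)\}$. Let $z_t$ be an oracle query point of the AINE algorithm with $p=3$ started at $x_0$, with the oracle $\mathbb O_3^\delta$ implemented by the BDGM subroutine (both described in the context). If $\|\nabla f(z_t)\|\ge\epsilon/R(x_0)$, then the BDGM subroutine called at $z_t$ terminates in a number of iterations no more than $$K=\mathrm{poly}\log\big(\delta^{-1},\epsilon^{-1},L_3,R(x_0),\|\nabla f(x_0)\|,\|\nabla^2f(x_0)\|,\|\nabla^3f(x_0)\|\big).$$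
   Context: Norms: Euclidean norm for vectors, operator norm for matrices and tensors. $\mathrm{poly}\log(\cdot)$ denotes a quantity polylogarithmic in the listed arguments. BDGM (Bregman distance gradient method) subroutine implementing $\mathbb O_3^\delta(z_t)$. Let $\xi>0$ be a numerical constant. Define $$f_t(y)=f(y)+\frac{(\xi^2-1)\delta}{2\xi}\|y-z_t\|^2+\frac{(1+\xi)\xi L_3}{24}\|y-z_t\|^4,$$ $$\rho_t(y)=\tfrac12\langle(H(z_t)+\xi\delta I_d)(y-z_t),y-z_t\rangle+\frac{(\xi+\xi^2)L_3}{12}\|y-z_t\|^4,$$ $R_t=2\big(12\|\nabla f(z_t)\|/(L_3(\xi^2-1))\big)^{1/3}$, and the Bregman distance $\beta_{\rho_t}(y,y')=\rho_t(y')-\rho_t(y)-\langle\nabla\rho_t(y),y'-y\rangle$. Start with $k=0$, $y_{t,0}=z_t$. For each $k$ let $\lambda_{t,k}=\frac{\xi^2-1}{\xi}\delta+\frac{(1+\xi)\xi L_3}{6}\|y_{t,k}-z_t\|^2$. While the MS condition $\|\nabla f(y_{t,k})+\lambda_{t,k}(y_{t,k}-z_t)\|\le\frac{\lambda_{t,k}}2\|y_{t,k}-z_t\|$ is not satisfied, set $$y_{t,k+1}=\arg\min_{\|y-z_t\|\le R_t}\{\langle\nabla f_t(y_{t,k}),y-y_{t,k}\rangle+2(1+1/\xi)\beta_{\rho_t}(y_{t,k},y)\},\qquad k\leftarrow k+1.$$ Upon termination return $(y_t,\lambda_t)=(y_{t,k},\lambda_{t,k})$. AINE algorithm for $p=3$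 ($D_0=\frac12\|x_0-x^*\|^2$). Initialize $v_0=z_0=x_0$, $A_0=0$, $(y_0,\lambda_0)=\mathbb O_3^\delta(z_0)$. For $t=0,\dots,T-1$: - Guess $\lambda'_t$: if $t=0$, $\lambda'_0=\lambda_0$; else if $t=1$ or $A_t>2A_s$ (where $s$ is the currently stored index), set $s:=t$, store $A_s=A_t$, and choose $\lambda'_t=\lambda'_s=\Theta\big(\delta+(D_0L_3/A_s^{3/2})^{2/5}\big)$; otherwise $\lambda'_t=\lambda'_s$ for the stored $s$. - $a'_{t+1}=\big(1+\sqrt{1+4\lambda'_tA_t}\big)/(2\lambda'_t)$, $A'_{t+1}=A_t+a'_{t+1}$, $z_t=(A_tx_t+a'_{t+1}v_t)/A'_{t+1}$. - If $t>0$: $(y_t,\lambda_t)=\mathbb O_3^\delta(z_t)$. - $\beta_t=\min\{1,\lambda'_t/\lambda_t\}$, $a_{t+1}=\beta_ta'_{t+1}$, $A_{t+1}=A_t+a_{t+1}$. - $\hat x_{t+1}=\big((1-\beta_t)A_tx_t+\beta_tA'_{t+1}y_t\big)/A_{t+1}$; $x_{t+1}$ is a point of $\{x_0,\dots,x_t,\hat x_{t+1}\}$ with smallest value of $f$; $v_{t+1}=v_t-a_{t+1}\nabla f(y_t)$. Return $x_T$.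
   Formalization: The numerical constant ξ is taken to be greater than 1 rather than merely positive, since for ξ ≤ 1 the radius R_t is undefined or negative and the BDGM step does not exist; also δ, ε > 0 and R(x_0) is finite, as the bound K presupposes. *)

theory Defs
  imports "HOL-Analysis.Analysis"
begin

text \<open>
  The constants hidden in a polylogarithmic bound must not depend on the dimension, so the
  dimension has to be quantified inside the statement. We therefore realise \<open>\<real>\<^sup>d\<close>,
  for a term-level \<open>d :: nat\<close>, as the subspace \<open>euclid d\<close> of the inner product space of
  finitely supported real sequences. The values of functions outside \<open>euclid d\<close> are irrelevant
  throughout.
\<close>

typedef fseq = "{x :: nat \<Rightarrow> real. finite {i. x i \<noteq> 0}}"
  morphisms coord Abs_fseq
  by (rule exI[of _ "\<lambda>_. 0"]) simp

setup_lifting type_definition_fseq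

lemma finite_coord: "finite {i. coord x i \<noteq> 0}"
  using coord[of x] by simp

lemma fseq_eqI: "(\<And>i. coord x i = coord y i) \<Longrightarrow> x = y"
  by (simp add: coord_inject[symmetric] fun_eq_iff)

instantiation fseq :: real_vector
begin

lift_definition zero_fseq :: fseq is "\<lambda>_. 0" by simp

lift_definition plus_fseq :: "fseq \<Rightarrow> fseq \<Rightarrow> fseq" is "\<lambda>x y i. x i + y i"
  by (erule (1) finite_subset[OF _ finite_UnI, rotated]) auto

lift_definition minus_fseq :: "fseq \<Rightarrow> fseq \<Rightarrow> fseq" is "\<lambda>x y i. x i - y i"
  by (erule (1) finite_subset[OF _ finite_UnI, rotated]) auto

lift_definition uminus_fseq :: "fseq \<Rightarrow> fseq" is "\<lambda>x i. - x i" by simp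

lift_definition scaleR_fseq :: "real \<Rightarrow> fseq \<Rightarrow> fseq" is "\<lambda>c x i. c * x i"
  by (erule finite_subset[rotated]) auto

instance
  by standard (transfer; simp add: algebra_simps fun_eq_iff)+

end

lemma coord_simps [simp]:
  "coord 0 i = 0" "coord (x + y) i = coord x i + coord y i"
  "coord (x - y) i = coord x i - coord y i" "coord (- x) i = - coord x i"
  "coord (c *\<^sub>R x) i = c * coord x i"
  by (transfer; simp)+

instantiation fseq :: real_inner
begin

definition inner_fseq :: "fseq \<Rightarrow> fseq \<Rightarrow> real" where
  "inner_fseq x y = (\<Sum>i | coord x i \<noteq> 0. coord x i * coord y i)"

definition norm_fseq :: "fseq \<Rightarrow> real" where
  "norm_fseq x = sqrt (inner x x)"

definition dist_fseq :: "fseq \<Rightarrow> fseq \<Rightarrow> real" where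
  "dist_fseq x y = norm (x - y)"

definition sgn_fseq :: "fseq \<Rightarrow> fseq" where
  "sgn_fseq x = x /\<^sub>R norm x"

definition uniformity_fseq :: "(fseq \<times> fseq) filter" where
  "uniformity_fseq = (INF e\<in>{0<..}. principal {(x, y). dist x y < e})"

definition open_fseq :: "fseq set \<Rightarrow> bool" where
  "open_fseq U \<longleftrightarrow> (\<forall>x\<in>U. \<forall>\<^sub>F (x', y) in uniformity. x' = x \<longrightarrow> y \<in> U)"

lemma inner_fseq_superset:
  assumes "finite I" "{i. coord x i \<noteq> 0} \<subseteq> I"
  shows "inner x y = (\<Sum>i\<in>I. coord x i * coord y i)"
  unfolding inner_fseq_def by (rule sum.mono_neutral_left) (use assms in auto)

instance
proof
  fix x y z :: fseq and r :: real and U :: "fseq set"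
  let ?I = "{i. coord x i \<noteq> 0} \<union> {i. coord y i \<noteq> 0}"
  have fin: "finite ?I"
    using finite_coord by simp
  have "inner x y = (\<Sum>i\<in>?I. coord x i * coord y i)"
    by (rule inner_fseq_superset[OF fin]) auto
  moreover have "inner y x = (\<Sum>i\<in>?I. coord y i * coord x i)"
    by (rule inner_fseq_superset[OF fin]) auto
  ultimately show "inner x y = inner y x"
    by (simp add: mult.commute)
  have "inner (x + y) z = (\<Sum>i\<in>?I. coord (x + y) i * coord z i)"
    by (rule inner_fseq_superset[OF fin]) auto
  moreover have "inner x z = (\<Sum>i\<in>?I. coord x i * coord z i)"
    by (rule inner_fseq_superset[OF fin]) auto
  moreover have "inner y z = (\<Sum>i\<in>?I. coord y i * coord z i)"
    by (rule inner_fseq_superset[OF fin]) auto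
  ultimately show "inner (x + y) z = inner x z + inner y z"
    by (simp add: algebra_simps sum.distrib)
  have "inner (r *\<^sub>R x) y = (\<Sum>i | coord x i \<noteq> 0. coord (r *\<^sub>R x) i * coord y i)"
    by (rule inner_fseq_superset[OF finite_coord]) auto
  then show "inner (r *\<^sub>R x) y = r * inner x y"
    by (simp add: inner_fseq_def sum_distrib_left mult.assoc)
  show "0 \<le> inner x x"
    by (simp add: inner_fseq_def sum_nonneg)
  show "inner x x = 0 \<longleftrightarrow> x = 0"
  proof
    assume "inner x x = 0"
    then have "\<forall>i\<in>{i. coord x i \<noteq> 0}. coord x i * coord x i = 0"
      unfolding inner_fseq_def using finite_coord by (subst (asm) sum_nonneg_eq_0_iff) auto
    then show "x = 0"
      by (intro fseq_eqI) auto
  qed (simp add: inner_fseq_def)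
qed (simp_all add: norm_fseq_def dist_fseq_def sgn_fseq_def uniformity_fseq_def open_fseq_def)

end

definition euclid :: "nat \<Rightarrow> fseq set" where
  "euclid d = {x. \<forall>i\<ge>d. coord x i = 0}"

lemma subspace_euclid: "subspace (euclid d)"
  by (auto simp: subspace_def euclid_def)

lemma inner_euclid: "x \<in> euclid d \<Longrightarrow> inner x y = (\<Sum>i<d. coord x i * coord y i)"
  by (rule inner_fseq_superset) (auto simp: euclid_def not_less[symmetric])

lemma bij_betw_euclid: "bij_betw coord (euclid d) {x. \<forall>i\<ge>d. x i = 0}"
proof (rule bij_betwI')
  fix y :: "nat \<Rightarrow> real"
  assume y: "y \<in> {x. \<forall>i\<ge>d. x i = 0}"
  then have "{i. y i \<noteq> 0} \<subseteq> {..<d}"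
    by (auto simp: not_less[symmetric])
  then have "coord (Abs_fseq y) = y"
    by (intro Abs_fseq_inverse) (simp add: finite_subset)
  with y show "\<exists>x\<in>euclid d. y = coord x"
    by (intro bexI[of _ "Abs_fseq y"]) (auto simp: euclid_def)
qed (auto simp: euclid_def coord_inject)


text \<open>
  Derivatives are taken within \<open>euclid d\<close>. They are unique as maps on \<open>euclid d\<close>, so the
  operators below are determined on arguments in \<open>euclid d\<close>. The Hessian is a linear operator
  \<open>h \<mapsto> \<nabla>\<^sup>2f(x) h\<close>, and \<open>third_deriv d f x u h\<close> is the vector \<open>\<nabla>\<^sup>3f(x)[h, u, \<cdot>]\<close>.
\<close>

definition grad :: "nat \<Rightarrow> (fseq \<Rightarrow> real) \<Rightarrow> fseq \<Rightarrow> fseq" where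
  "grad d f x =
     (THE g. g \<in> euclid d \<and> (f has_derivative (\<lambda>h. inner g h)) (at x within euclid d))"

definition hess :: "nat \<Rightarrow> (fseq \<Rightarrow> real) \<Rightarrow> fseq \<Rightarrow> fseq \<Rightarrow> fseq" where
  "hess d f x = frechet_derivative (grad d f) (at x within euclid d)"

definition third_deriv :: "nat \<Rightarrow> (fseq \<Rightarrow> real) \<Rightarrow> fseq \<Rightarrow> fseq \<Rightarrow> fseq \<Rightarrow> fseq" where
  "third_deriv d f x u = frechet_derivative (\<lambda>y. hess d f y u) (at x within euclid d)"

text \<open>
  In finite dimension, differentiability of \<open>\<nabla>\<^sup>2f\<close> and continuity of \<open>\<nabla>\<^sup>3f\<close> in operator norm
  are the same as the pointwise conditions used here.
\<close>

definition C3 :: "nat \<Rightarrow> (fseq \<Rightarrow> real) \<Rightarrow> bool" where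
  "C3 d f \<longleftrightarrow>
     f differentiable_on euclid d \<and>
     grad d f differentiable_on euclid d \<and>
     (\<forall>u\<in>euclid d. (\<lambda>x. hess d f x u) differentiable_on euclid d) \<and>
     (\<forall>u\<in>euclid d. \<forall>v\<in>euclid d. continuous_on (euclid d) (\<lambda>x. third_deriv d f x u v))"

abbreviation unit_ball :: "nat \<Rightarrow> fseq set" where
  "unit_ball d \<equiv> {h \<in> euclid d. norm h \<le> 1}"

definition opnorm2 :: "nat \<Rightarrow> (fseq \<Rightarrow> fseq) \<Rightarrow> real" where
  "opnorm2 d M = (SUP h\<in>unit_ball d. norm (M h))"

definition opnorm3 :: "nat \<Rightarrow> (fseq \<Rightarrow> fseq \<Rightarrow> fseq) \<Rightarrow> real" where
  "opnorm3 d T = (SUP (u, v, w)\<in>unit_ball d \<times> unit_ball d \<times> unit_ball d. \<bar>inner (T u v) w\<bar>)"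

definition third_deriv_lipschitz :: "nat \<Rightarrow> (fseq \<Rightarrow> real) \<Rightarrow> real \<Rightarrow> bool" where
  "third_deriv_lipschitz d f L3 \<longleftrightarrow>
     (\<forall>x\<in>euclid d. \<forall>y\<in>euclid d.
        opnorm3 d (\<lambda>u v. third_deriv d f x u v - third_deriv d f y u v) \<le> L3 * norm (x - y))"

text \<open>
  \<open>linear (H x)\<close> is stated on the whole type; this loses nothing, as every linear operator on
  \<open>euclid d\<close> extends linearly.
\<close>

definition hessian_estimator ::
  "nat \<Rightarrow> (fseq \<Rightarrow> real) \<Rightarrow> real \<Rightarrow> (fseq \<Rightarrow> fseq \<Rightarrow> fseq) \<Rightarrow> bool" where
  "hessian_estimator d f \<delta> H \<longleftrightarrow>
     (\<forall>x\<in>euclid d.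
        linear (H x) \<and> H x ` euclid d \<subseteq> euclid d \<and>
        (\<forall>u\<in>euclid d. \<forall>v\<in>euclid d. inner (H x u) v = inner u (H x v)) \<and>
        opnorm2 d (\<lambda>h. H x h - hess d f x h) \<le> \<delta>)"

definition sublevel :: "nat \<Rightarrow> (fseq \<Rightarrow> real) \<Rightarrow> fseq \<Rightarrow> fseq set" where
  "sublevel d f x0 = {y \<in> euclid d. f y \<le> f x0}"

definition sublevel_radius :: "nat \<Rightarrow> (fseq \<Rightarrow> real) \<Rightarrow> fseq \<Rightarrow> fseq \<Rightarrow> real" where
  "sublevel_radius d f xstar x0 = (SUP y\<in>sublevel d f x0. norm (y - xstar))"

definition bregman :: "nat \<Rightarrow> (fseq \<Rightarrow> real) \<Rightarrow> fseq \<Rightarrow> fseq \<Rightarrow> real" where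
  "bregman d \<rho> y y' = \<rho> y' - \<rho> y - inner (grad d \<rho> y) (y' - y)"


locale bdgm =
  fixes d :: nat and f :: "fseq \<Rightarrow> real" and H :: "fseq \<Rightarrow> fseq \<Rightarrow> fseq"
    and \<delta> L3 \<xi> :: real
begin

definition reg_obj :: "fseq \<Rightarrow> fseq \<Rightarrow> real" where
  "reg_obj z y = f y + (\<xi>\<^sup>2 - 1) * \<delta> / (2 * \<xi>) * norm (y - z) ^ 2
     + (1 + \<xi>) * \<xi> * L3 / 24 * norm (y - z) ^ 4"

definition ref_fun :: "fseq \<Rightarrow> fseq \<Rightarrow> real" where
  "ref_fun z y = 1/2 * inner (H z (y - z) + (\<xi> * \<delta>) *\<^sub>R (y - z)) (y - z)
     + (\<xi> + \<xi>\<^sup>2) * L3 / 12 * norm (y - z) ^ 4"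

definition radius :: "fseq \<Rightarrow> real" where
  "radius z = 2 * root 3 (12 * norm (grad d f z) / (L3 * (\<xi>\<^sup>2 - 1)))"

definition lam :: "fseq \<Rightarrow> fseq \<Rightarrow> real" where
  "lam z y = (\<xi>\<^sup>2 - 1) / \<xi> * \<delta> + (1 + \<xi>) * \<xi> * L3 / 6 * norm (y - z) ^ 2"

definition MS :: "fseq \<Rightarrow> fseq \<Rightarrow> bool" where
  "MS z y \<longleftrightarrow> norm (grad d f y + lam z y *\<^sub>R (y - z)) \<le> lam z y / 2 * norm (y - z)"

definition step :: "fseq \<Rightarrow> fseq \<Rightarrow> fseq \<Rightarrow> bool" where
  "step z y y' \<longleftrightarrow>
     is_arg_min
       (\<lambda>u. inner (grad d (reg_obj z) y) (u - y) + 2 * (1 + 1 / \<xi>) * bregman d (ref_fun z) y u)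
       (\<lambda>u. u \<in> euclid d \<and> norm (u - z) \<le> radius z) y'"

text \<open>\<open>trace z y n\<close>: the loop started at \<open>z\<close> has performed \<open>n\<close> iterations, with iterates
  \<open>y 0, \<dots>, y n\<close>; whether it stops at \<open>y n\<close> is left open.\<close>

definition trace :: "fseq \<Rightarrow> (nat \<Rightarrow> fseq) \<Rightarrow> nat \<Rightarrow> bool" where
  "trace z y n \<longleftrightarrow> y 0 = z \<and> (\<forall>k<n. \<not> MS z (y k) \<and> step z (y k) (y (Suc k)))"

definition returns :: "fseq \<Rightarrow> fseq \<Rightarrow> real \<Rightarrow> bool" where
  "returns z y' l \<longleftrightarrow> (\<exists>y n. trace z y n \<and> MS z (y n) \<and> y' = y n \<and> l = lam z (y n))"

text \<open>No execution exceeds \<open>K\<close> iterations, and no execution gets stuck for lack of a minimiser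
  before the MS condition holds.\<close>

definition terminates_within :: "fseq \<Rightarrow> real \<Rightarrow> bool" where
  "terminates_within z K \<longleftrightarrow>
     (\<forall>y n. trace z y n \<longrightarrow> real n \<le> K \<and> (MS z (y n) \<or> (\<exists>y'. step z (y n) y')))"

end


text \<open>\<open>lam'\<close>, \<open>a'\<close> and \<open>A'\<close> are the primed quantities. \<open>stored t\<close> is the stored index \<open>s\<close> after
  the guess of iteration \<open>t\<close>; it is meaningful for \<open>t \<ge> 1\<close> only.\<close>

record aine_run =
  xs :: "nat \<Rightarrow> fseq"
  vs :: "nat \<Rightarrow> fseq"
  zs :: "nat \<Rightarrow> fseq"
  ys :: "nat \<Rightarrow> fseq"
  lams :: "nat \<Rightarrow> real"
  lams' :: "nat \<Rightarrow> real"
  as :: "nat \<Rightarrow> real"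
  as' :: "nat \<Rightarrow> real"
  As :: "nat \<Rightarrow> real"
  As' :: "nat \<Rightarrow> real"
  stored :: "nat \<Rightarrow> nat"

text \<open>\<open>c1\<close> and \<open>c2\<close> are the constants in the \<open>\<Theta>\<close> of the guess of \<open>\<lambda>'\<close>.\<close>

locale aine = bdgm +
  fixes c1 c2 :: real and xstar x0 :: fseq
begin

definition D0 :: real where
  "D0 = 1/2 * norm (x0 - xstar) ^ 2"

definition guess_scale :: "real \<Rightarrow> real" where
  "guess_scale A = \<delta> + (D0 * L3 / A powr (3/2)) powr (2/5)"

definition init :: "aine_run \<Rightarrow> bool" where
  "init r \<longleftrightarrow> xs r 0 = x0 \<and> vs r 0 = x0 \<and> zs r 0 = x0 \<and> As r 0 = 0"

definition guess :: "aine_run \<Rightarrow> nat \<Rightarrow> bool" where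
  "guess r t \<longleftrightarrow>
     (if t = 0 then lams' r 0 = lams r 0
      else if t = 1 \<or> As r t > 2 * As r (stored r (t - 1)) then
        stored r t = t \<and>
        c1 * guess_scale (As r t) \<le> lams' r t \<and> lams' r t \<le> c2 * guess_scale (As r t)
      else stored r t = stored r (t - 1) \<and> lams' r t = lams' r (stored r t))"

definition query :: "aine_run \<Rightarrow> nat \<Rightarrow> bool" where
  "query r t \<longleftrightarrow>
     as' r (Suc t) = (1 + sqrt (1 + 4 * lams' r t * As r t)) / (2 * lams' r t) \<and>
     As' r (Suc t) = As r t + as' r (Suc t) \<and>
     zs r t = (As r t *\<^sub>R xs r t + as' r (Suc t) *\<^sub>R vs r t) /\<^sub>R As' r (Suc t)"

definition update :: "aine_run \<Rightarrow> nat \<Rightarrow> bool" where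
  "update r t \<longleftrightarrow>
     (let \<beta> = min 1 (lams' r t / lams r t);
          xhat = (((1 - \<beta>) * As r t) *\<^sub>R xs r t + (\<beta> * As' r (Suc t)) *\<^sub>R ys r t)
                   /\<^sub>R As r (Suc t)
      in as r (Suc t) = \<beta> * as' r (Suc t) \<and>
         As r (Suc t) = As r t + as r (Suc t) \<and>
         is_arg_min f (\<lambda>u. u \<in> insert xhat (xs r ` {..t})) (xs r (Suc t)) \<and>
         vs r (Suc t) = vs r t - as r (Suc t) *\<^sub>R grad d f (ys r t))"

text \<open>
  The run reaches the oracle query at \<open>zs r t\<close>: iterations \<open>0, \<dots>, t - 1\<close> are complete, so all
  earlier oracle calls have returned, and \<open>zs r t\<close> has been computed. The query at
  \<open>zs r 0 = x0\<close> is made before the loop, which is why the guess of iteration \<open>0\<close> (which uses its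
  answer) is not required in order to reach it.
\<close>

definition reaches_query :: "aine_run \<Rightarrow> nat \<Rightarrow> bool" where
  "reaches_query r t \<longleftrightarrow>
     init r \<and>
     (\<forall>j<t. guess r j \<and> query r j \<and> returns (zs r j) (ys r j) (lams r j) \<and> update r j) \<and>
     (0 < t \<longrightarrow> guess r t \<and> query r t)"

definition query_point :: "fseq \<Rightarrow> bool" where
  "query_point z \<longleftrightarrow> (\<exists>r t. reaches_query r t \<and> z = zs r t)"

end


text \<open>
  Bounded by a polynomial in the logarithms of the arguments. As usual, a logarithm is read in a
  way that is nonnegative for small arguments, here \<open>ln (1 + a)\<close>; the leading \<open>1\<close> allows for
  a constant term.
\<close>

definition polylog :: "(real list \<Rightarrow> real) \<Rightarrow> bool" where
  "polylog K \<longleftrightarrow>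
     (\<exists>C p. \<forall>args. (\<forall>a\<in>set args. 0 \<le> a) \<longrightarrow>
        K args \<le> C * (1 + (\<Sum>a\<leftarrow>args. ln (1 + a))) ^ p)"

end

theory Submission
  imports Defs
begin

text \<open>
  Convexity at \<open>z \<plusminus> \<xi> h\<close> controls the third derivative by the Hessian, so that \<open>f\<^sub>t\<close> is smooth and strongly
  convex relative to \<open>\<rho>\<^sub>t\<close>, with constants depending on \<open>\<xi>\<close> only. The mirror descent steps
  therefore contract the Bregman distance to the minimizer \<open>u\<close> of \<open>f\<^sub>t\<close> linearly. Let \<open>M\<close> be
  the smoothness constant of \<open>f\<^sub>t\<close> near \<open>z\<close>. If \<open>y\<close> violates the MS condition, then \<open>\<parallel>y - u\<parallel>\<close> is at
  least of order \<open>(\<delta> / M) \<parallel>u - z\<parallel>\<close>, while the initial Bregman distance is at most of order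
  \<open>M \<parallel>u - z\<parallel>\<^sup>2\<close>; so the number of iterations is logarithmic in \<open>M / \<delta>\<close>. Finally \<open>M\<close> is at most
  \<open>\<delta>\<close> times a polynomial in \<open>1 / \<delta>\<close>, \<open>L\<^sub>3\<close>, \<open>R(x\<^sub>0)\<close> and the derivatives at \<open>x\<^sub>0\<close>, because the potential of the accelerated method keeps \<open>x\<^sub>t\<close>, \<open>v\<^sub>t\<close>, and hence the query point, within
  distance \<open>R(x\<^sub>0)\<close> of \<open>x\<^sup>*\<close>.
\<close>

section \<open>The spaces \<open>euclid d\<close>\<close>

text \<open>The function \<open>K\<close> is fixed before the dimension, \<open>f\<close> and
  \<open>\<delta>\<close> are given. The contraction factor may therefore depend on \<xi> alone,
  which is why convergence is measured relative to \<open>ref_fun z\<close> and not by eigenvalues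
  of the Hessian; all other data enter only through the logarithm of a ratio. The list of arguments
  contains \<open>L3\<close> but not its inverse, whereas the radius of the constraint ball grows
  without bound as \<open>L3\<close> tends to 0. So that radius cannot serve to bound the smoothness
  constant over the iterates. Two substitutes are used: the quadratic regularizer gives
  \<open>lam_min * norm (u - z) \<le> norm (grad d f z)\<close> for the minimizer \<open>u\<close>,
  and the contraction together with strong convexity of \<open>ref_fun z\<close> keeps the iterates
  within a multiple of \<open>norm (u - z)\<close> from \<open>z\<close>. Both involve only the
  inverse of \<delta>. The ambient type is infinite dimensional, so compactness, boundedness of
  linear maps and finiteness of operator norms are derived from coordinates in
  \<open>euclid d\<close>, and calculus is reduced to real functions along lines.\<close>

definition unit_vec :: "nat \<Rightarrow> fseq" where
  "unit_vec i = Abs_fseq (\<lambda>j. if j = i then 1 else 0)"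

lemma coord_unit_vec: "coord (unit_vec i) j = (if j = i then 1 else 0)"
  unfolding unit_vec_def by (subst Abs_fseq_inverse) auto

lemma unit_vec_in_euclid: "i < d \<Longrightarrow> unit_vec i \<in> euclid d"
  by (auto simp: euclid_def coord_unit_vec)

lemma inner_unit_vec: "inner (unit_vec i) x = coord x i"
proof -
  have "inner (unit_vec i) x = (\<Sum>j\<in>{i}. coord (unit_vec i) j * coord x j)"
    by (rule inner_fseq_superset) (auto simp: coord_unit_vec split: if_splits)
  then show ?thesis
    by (simp add: coord_unit_vec)
qed

lemma norm_unit_vec: "norm (unit_vec i) = 1"
  by (simp add: norm_eq_sqrt_inner inner_unit_vec coord_unit_vec)

lemma abs_coord_le_norm: "\<bar>coord x i\<bar> \<le> norm x"
  using Cauchy_Schwarz_ineq2[of "unit_vec i" x] by (simp add: inner_unit_vec norm_unit_vec)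

lemma coord_sum: "coord (\<Sum>i\<in>A. g i) j = (\<Sum>i\<in>A. coord (g i) j)"
  by (induction A rule: infinite_finite_induct) auto

lemma euclid_expansion:
  assumes "x \<in> euclid d"
  shows "x = (\<Sum>i<d. coord x i *\<^sub>R unit_vec i)"
proof (rule fseq_eqI)
  fix j
  show "coord x j = coord (\<Sum>i<d. coord x i *\<^sub>R unit_vec i) j"
    using assms by (auto simp: coord_sum coord_unit_vec euclid_def if_distrib cong: if_cong)
qed

lemma euclid_closure [simp, intro]:
  "0 \<in> euclid d"
  "x \<in> euclid d \<Longrightarrow> y \<in> euclid d \<Longrightarrow> x + y \<in> euclid d"
  "x \<in> euclid d \<Longrightarrow> y \<in> euclid d \<Longrightarrow> x - y \<in> euclid d"
  "x \<in> euclid d \<Longrightarrow> - x \<in> euclid d"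
  "x \<in> euclid d \<Longrightarrow> c *\<^sub>R x \<in> euclid d"
  by (auto simp: euclid_def)

lemma bounded_linear_coord: "bounded_linear (\<lambda>x. coord x i)"
  using bounded_linear_inner_right[of "unit_vec i"] by (simp add: inner_unit_vec)

lemma linear_euclid_expansion:
  assumes "linear T" "x \<in> euclid d"
  shows "T x = (\<Sum>i<d. coord x i *\<^sub>R T (unit_vec i))"
proof -
  have "T x = T (\<Sum>i<d. coord x i *\<^sub>R unit_vec i)"
    using euclid_expansion[OF assms(2)] by simp
  also have "\<dots> = (\<Sum>i<d. coord x i *\<^sub>R T (unit_vec i))"
    by (simp add: linear_sum[OF assms(1)] linear_scale[OF assms(1)])
  finally show ?thesis .
qed

text \<open>The whole space is infinite dimensional, so a linear operator need not be bounded; this is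
  a bounded operator that agrees with \<open>T\<close> on \<open>euclid d\<close>.\<close>

definition truncate :: "nat \<Rightarrow> (fseq \<Rightarrow> fseq) \<Rightarrow> fseq \<Rightarrow> fseq" where
  "truncate d T x = (\<Sum>i<d. coord x i *\<^sub>R T (unit_vec i))"

lemma bounded_linear_truncate: "bounded_linear (truncate d T)"
  unfolding truncate_def
  by (intro bounded_linear_sum bounded_linear_scaleR_const bounded_linear_coord)

lemma truncate_eq: "linear T \<Longrightarrow> x \<in> euclid d \<Longrightarrow> truncate d T x = T x"
  by (simp add: truncate_def linear_euclid_expansion[of T x d])

lemma closed_euclid: "closed (euclid d)"
proof -
  have "euclid d = (\<Inter>i\<in>{d..}. (\<lambda>x. coord x i) -` {0})"
    by (auto simp: euclid_def)
  moreover have "closed ((\<lambda>x. coord x i) -` {0})" for i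
    by (intro continuous_closed_vimage closed_singleton linear_continuous_at bounded_linear_coord)
  ultimately show ?thesis
    by auto
qed

text \<open>Closed bounded sets of the ambient type need not be compact. The box of dimension
  \<open>Suc d\<close> is the continuous image of the product of the box of dimension
  \<open>d\<close> with an interval, which gives an induction on \<open>d\<close>.\<close>

lemma compact_euclid_box: "compact {x \<in> euclid d. \<forall>i. \<bar>coord x i\<bar> \<le> r}" (is "compact (?B d)")
proof (cases "0 \<le> r")
  case True
  show ?thesis
  proof (induction d)
    case 0
    have "?B 0 = {0}"
      using True by (auto simp: euclid_def intro: fseq_eqI)
    then show ?case
      by simp
  next
    case (Suc d)
    let ?F = "\<lambda>(x, t). x + t *\<^sub>R unit_vec d"
    have "compact (?F ` (?B d \<times> {-r..r}))"
      unfolding case_prod_unfold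
      by (intro compact_continuous_image compact_Times Suc continuous_intros) auto
    moreover have "?B (Suc d) = ?F ` (?B d \<times> {-r..r})"
    proof (intro equalityI subsetI)
      fix x assume x: "x \<in> ?B (Suc d)"
      have "x - coord x d *\<^sub>R unit_vec d \<in> ?B d"
        using x True by (auto simp: euclid_def coord_unit_vec not_less_eq_eq[symmetric] le_less_Suc_eq)
      moreover have "coord x d \<in> {-r..r}"
      proof -
        have "\<bar>coord x d\<bar> \<le> r"
          using x by blast
        then show ?thesis
          by (simp add: abs_le_iff)
      qed
      ultimately show "x \<in> ?F ` (?B d \<times> {-r..r})"
        by (intro image_eqI[of _ _ "(x - coord x d *\<^sub>R unit_vec d, coord x d)"]) auto
    next
      fix x assume "x \<in> ?F ` (?B d \<times> {-r..r})"
      then show "x \<in> ?B (Suc d)"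
        by (auto simp: euclid_def coord_unit_vec)
    qed
    ultimately show ?case
      by simp
  qed
next
  case False
  then have "?B d = {}"
    using abs_ge_zero order_trans by blast
  then show ?thesis
    by (simp only: compact_empty)
qed

lemma compact_euclid_cball: "compact {x \<in> euclid d. norm (x - z) \<le> r}"
proof -
  let ?S = "{x \<in> euclid d. norm (x - z) \<le> r}"
  have "?S = euclid d \<inter> cball z r"
    by (auto simp: dist_norm norm_minus_commute)
  then have "closed ?S"
    using closed_euclid by auto
  moreover have "?S \<subseteq> {x \<in> euclid d. \<forall>i. \<bar>coord x i\<bar> \<le> r + norm z}"
  proof (safe)
    fix x i assume "norm (x - z) \<le> r"
    moreover have "norm x \<le> norm (x - z) + norm z"
      using norm_triangle_ineq[of "x - z" z] by simp
    ultimately show "\<bar>coord x i\<bar> \<le> r + norm z"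
      using abs_coord_le_norm[of x i] by linarith
  qed
  ultimately show ?thesis
    using compact_Int_closed[OF compact_euclid_box, of ?S d "r + norm z"]
    by (simp only: inf.absorb2)
qed

section \<open>Derivatives within \<open>euclid d\<close>\<close>

text \<open>A line in \<open>euclid d\<close> never leaves the subspace, so a derivative within it
  becomes an unrestricted derivative in the real parameter. The later estimates all go through such
  one variable functions.\<close>

lemma has_derivative_line:
  assumes "(g has_derivative D) (at (x + s *\<^sub>R h) within euclid d)"
    and "x \<in> euclid d" "h \<in> euclid d"
  shows "((\<lambda>s. g (x + s *\<^sub>R h)) has_derivative (\<lambda>t. D (t *\<^sub>R h))) (at s)"
proof (rule has_derivative_in_compose[where f = "\<lambda>s. x + s *\<^sub>R h" and g = g])
  show "((\<lambda>s. x + s *\<^sub>R h) has_derivative (\<lambda>t. t *\<^sub>R h)) (at s)"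
    by (auto intro!: derivative_eq_intros)
  show "(g has_derivative D) (at (x + s *\<^sub>R h) within range (\<lambda>s. x + s *\<^sub>R h))"
    by (rule has_derivative_subset[OF assms(1)]) (use assms in auto)
qed

lemma DERIV_line:
  fixes g :: "fseq \<Rightarrow> real"
  assumes "(g has_derivative D) (at (x + s *\<^sub>R h) within euclid d)"
    and "x \<in> euclid d" "h \<in> euclid d"
  shows "((\<lambda>s. g (x + s *\<^sub>R h)) has_real_derivative D h) (at s)"
proof -
  have "(\<lambda>t. D (t *\<^sub>R h)) = (*) (D h)"
    using linear_scale[OF has_derivative_linear[OF assms(1)]] by (auto simp: mult.commute)
  then show ?thesis
    using has_derivative_line[OF assms] by (simp add: has_field_derivative_def)
qed

lemma DERIV_line_inner:
  fixes g :: "fseq \<Rightarrow> fseq"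
  assumes "(g has_derivative D) (at (x + s *\<^sub>R h) within euclid d)"
    and "x \<in> euclid d" "h \<in> euclid d"
  shows "((\<lambda>s. inner (g (x + s *\<^sub>R h)) w) has_real_derivative inner (D h) w) (at s)"
  by (rule DERIV_line[OF has_derivative_inner_left[OF assms(1)] assms(2,3)])

lemma gradient_unique:
  assumes "(F has_derivative (\<lambda>h. inner g h)) (at x within euclid d)"
    and "(F has_derivative (\<lambda>h. inner g' h)) (at x within euclid d)"
    and "x \<in> euclid d" "g \<in> euclid d" "g' \<in> euclid d"
  shows "g = g'"
proof -
  have h: "g - g' \<in> euclid d"
    using assms by auto
  have "inner g (g - g') = inner g' (g - g')"
    using DERIV_line[of F "inner g" x 0 "g - g'" d] DERIV_line[of F "inner g'" x 0 "g - g'" d]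
      assms h DERIV_unique by fastforce
  then have "inner (g - g') (g - g') = 0"
    by (simp add: inner_diff_left)
  then show ?thesis
    by simp
qed

lemma grad_eqI:
  assumes "(F has_derivative (\<lambda>h. inner g h)) (at x within euclid d)"
    and "x \<in> euclid d" "g \<in> euclid d"
  shows "grad d F x = g"
  unfolding grad_def using assms gradient_unique by (intro the_equality) blast+

text \<open>A derivative within \<open>euclid d\<close> is determined only on
  \<open>euclid d\<close>, since the difference quotient sees no other increments; off the subspace
  it may be replaced by any bounded linear extension, here \<open>inner g\<close>.\<close>

lemma has_derivative_gradientI:
  fixes F :: "fseq \<Rightarrow> real"
  assumes D: "(F has_derivative D) (at x within euclid d)" and x: "x \<in> euclid d"
    and eq: "\<And>h. h \<in> euclid d \<Longrightarrow> D h = inner g h"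
  shows "(F has_derivative (\<lambda>h. inner g h)) (at x within euclid d)"
  unfolding has_derivative_within
proof
  show "bounded_linear (inner g)"
    by (rule bounded_linear_inner_right)
  have "((\<lambda>y. (1 / norm (y - x)) *\<^sub>R (F y - (F x + D (y - x)))) \<longlongrightarrow> 0) (at x within euclid d)"
    using D unfolding has_derivative_within by simp
  then show "((\<lambda>y. (1 / norm (y - x)) *\<^sub>R (F y - (F x + inner g (y - x)))) \<longlongrightarrow> 0) (at x within euclid d)"
    by (rule Lim_transform_eventually) (use x eq in \<open>auto simp: eventually_at_filter\<close>)
qed

lemma has_derivative_grad:
  assumes "F differentiable (at x within euclid d)" "x \<in> euclid d"
  shows "grad d F x \<in> euclid d"
    and "(F has_derivative (\<lambda>h. inner (grad d F x) h)) (at x within euclid d)"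
proof -
  obtain D where D: "(F has_derivative D) (at x within euclid d)"
    using assms(1) by (auto simp: differentiable_def)
  \<comment> \<open>The Riesz representative of \<open>D\<close> restricted to
    \<open>euclid d\<close>, written in coordinates.\<close>
  define g where "g = (\<Sum>i<d. D (unit_vec i) *\<^sub>R unit_vec i)"
  have g: "g \<in> euclid d"
    unfolding g_def by (intro subspace_sum[OF subspace_euclid] subspace_scale[OF subspace_euclid])
      (auto intro: unit_vec_in_euclid)
  have eq: "inner g h = D h" if "h \<in> euclid d" for h
  proof -
    have lin: "linear D"
      using D by (rule has_derivative_linear)
    have "D h = D (\<Sum>i<d. coord h i *\<^sub>R unit_vec i)"
      using euclid_expansion[OF that] by simp
    also have "\<dots> = (\<Sum>i<d. coord h i * D (unit_vec i))"
      by (simp add: linear_sum[OF lin] linear_scale[OF lin])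
    also have "\<dots> = inner g h"
      by (simp add: g_def inner_sum_left inner_unit_vec mult.commute)
    finally show ?thesis ..
  qed
  have "(F has_derivative (\<lambda>h. inner g h)) (at x within euclid d)"
    using D assms(2) eq by (intro has_derivative_gradientI) auto
  moreover from this have "grad d F x = g"
    using assms g by (intro grad_eqI) auto
  ultimately show "grad d F x \<in> euclid d"
    and "(F has_derivative (\<lambda>h. inner (grad d F x) h)) (at x within euclid d)"
    using g by auto
qed

text \<open>A negative slope of \<open>F\<close> at \<open>y\<close> towards \<open>u\<close> would
  give a smaller value at a nearby point of the segment, which lies in \<open>C\<close> by
  convexity.\<close>

lemma minimizer_variational_inequality:
  assumes min: "\<And>v. v \<in> C \<Longrightarrow> F y \<le> F v"
    and C: "convex C" "C \<subseteq> euclid d" "y \<in> C" "u \<in> C"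
    and F: "(F has_derivative (\<lambda>h. inner g h)) (at y within euclid d)"
  shows "0 \<le> inner g (u - y)"
proof (rule ccontr)
  assume neg: "\<not> 0 \<le> inner g (u - y)"
  have "((\<lambda>s. F (y + s *\<^sub>R (u - y))) has_real_derivative inner g (u - y)) (at 0)"
    by (rule DERIV_line) (use F C in auto)
  from DERIV_neg_dec_right[OF this] neg
  obtain e where e: "e > 0" "\<And>t. 0 < t \<Longrightarrow> t < e \<Longrightarrow> F (y + t *\<^sub>R (u - y)) < F y"
    by auto
  define t where "t = min (e / 2) 1"
  have t: "0 < t" "t < e" "t \<le> 1"
    using e(1) by (auto simp: t_def)
  have "y + t *\<^sub>R (u - y) = (1 - t) *\<^sub>R y + t *\<^sub>R u"
    by (simp add: algebra_simps)
  then have "y + t *\<^sub>R (u - y) \<in> C"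
    using C t by (auto intro: convexD_alt)
  then show False
    using min e(2)[of t] t by force
qed

text \<open>Applied below to differences of two functions along a segment: an inequality between
  Hessian forms becomes one between Bregman distances.\<close>

lemma second_order_convexity:
  fixes p :: "real \<Rightarrow> real"
  assumes p: "\<And>s. (p has_real_derivative p' s) (at s)"
    and p': "\<And>s. (p' has_real_derivative p'' s) (at s)"
    and nonneg: "\<And>s. 0 \<le> p'' s"
  shows "p 0 + p' 0 \<le> p 1"
proof -
  obtain s where s: "0 < s" "s < 1" "p 1 - p 0 = (1 - 0) * p' s"
    using MVT2[of 0 1 p p'] p by auto
  have "p' 0 \<le> p' s"
    by (rule DERIV_nonneg_imp_nondecreasing[of 0 s]) (use s p' nonneg in auto)
  with s show ?thesis
    by simp
qed

text \<open>Adding or subtracting \<open>K * s\<^sup>2 / 2\<close> to the remainder makes it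
  monotone on the unit interval, so no second derivative of \<open>p\<close> is involved.\<close>

lemma taylor_Lipschitz_derivative:
  fixes p :: "real \<Rightarrow> real"
  assumes p: "\<And>s. (p has_real_derivative p' s) (at s)"
    and K: "\<And>s. 0 \<le> s \<Longrightarrow> \<bar>p' s - p' 0\<bar> \<le> K * s"
  shows "\<bar>p 1 - p 0 - p' 0\<bar> \<le> K / 2"
proof -
  have "p 0 - 0 * p' 0 + K * 0\<^sup>2 / 2 \<le> p 1 - 1 * p' 0 + K * 1\<^sup>2 / 2"
  proof (rule DERIV_nonneg_imp_nondecreasing[of 0 1 "\<lambda>s. p s - s * p' 0 + K * s\<^sup>2 / 2"])
    fix s :: real assume s: "0 \<le> s" "s \<le> 1"
    have "((\<lambda>s. p s - s * p' 0 + K * s\<^sup>2 / 2) has_real_derivative p' s - p' 0 + K * s) (at s)"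
      by (auto intro!: derivative_eq_intros p)
    then show "\<exists>y. ((\<lambda>s. p s - s * p' 0 + K * s\<^sup>2 / 2) has_real_derivative y) (at s) \<and> 0 \<le> y"
      using K[OF s(1)] by (auto intro!: exI)
  qed simp
  moreover have "p 0 - 0 * p' 0 - K * 0\<^sup>2 / 2 \<ge> p 1 - 1 * p' 0 - K * 1\<^sup>2 / 2"
  proof (rule DERIV_nonpos_imp_nonincreasing[of 0 1 "\<lambda>s. p s - s * p' 0 - K * s\<^sup>2 / 2"])
    fix s :: real assume s: "0 \<le> s" "s \<le> 1"
    have "((\<lambda>s. p s - s * p' 0 - K * s\<^sup>2 / 2) has_real_derivative p' s - p' 0 - K * s) (at s)"
      by (auto intro!: derivative_eq_intros p)
    then show "\<exists>y. ((\<lambda>s. p s - s * p' 0 - K * s\<^sup>2 / 2) has_real_derivative y) (at s) \<and> y \<le> 0"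
      using K[OF s(1)] by (auto intro!: exI)
  qed simp
  ultimately show ?thesis
    by (simp add: field_simps abs_if)
qed

section \<open>Convex functions with Lipschitz third derivative\<close>

lemma unit_ball_normalize: "u \<in> euclid d \<Longrightarrow> u /\<^sub>R norm u \<in> unit_ball d"
  by (cases "u = 0") auto

text \<open>The supremum defining \<open>opnorm2\<close> is meaningful only over a set that is
  bounded above. The bound comes from \<open>truncate\<close>, which is a bounded operator even when
  \<open>M\<close> is not.\<close>

lemma bdd_above_opnorm2:
  fixes M :: "fseq \<Rightarrow> fseq"
  assumes "linear M"
  shows "bdd_above ((\<lambda>h. norm (M h)) ` unit_ball d)"
proof -
  obtain C where C: "\<And>x. norm (truncate d M x) \<le> norm x * C" "C \<ge> 0"
    using bounded_linear.nonneg_bounded[OF bounded_linear_truncate] by blast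
  have "norm (M h) \<le> C" if "h \<in> unit_ball d" for h
  proof -
    have "norm (M h) \<le> norm h * C"
      using C(1)[of h] truncate_eq[OF assms(1), of h d] that by simp
    also have "\<dots> \<le> 1 * C"
      using that C(2) by (intro mult_right_mono) auto
    finally show ?thesis
      by simp
  qed
  then show ?thesis
    by (rule bdd_aboveI2)
qed

lemma opnorm2_nonneg: "linear M \<Longrightarrow> 0 \<le> opnorm2 d M"
  unfolding opnorm2_def by (rule cSUP_upper2[OF bdd_above_opnorm2, of _ 0]) auto

lemma linear_le_opnorm2:
  assumes "linear M" "u \<in> euclid d"
  shows "norm (M u) \<le> opnorm2 d M * norm u"
proof (cases "u = 0")
  case True
  then show ?thesis
    using linear_0[OF assms(1)] by simp
next
  case False
  have "norm (M (u /\<^sub>R norm u)) \<le> opnorm2 d M"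
    unfolding opnorm2_def using assms
    by (intro cSUP_upper unit_ball_normalize bdd_above_opnorm2)
  then show ?thesis
    using False by (simp add: linear_scale[OF assms(1)] field_simps)
qed

text \<open>\<open>third_deriv d f x u\<close> is controlled for \<open>u\<close> in
  \<open>euclid d\<close> only, so linearity is asked for there only, as an expansion in unit
  vectors; this form also yields a finite bound on the unit balls at once. Linearity in
  \<open>w\<close> comes from the inner product.\<close>

definition trilinear :: "nat \<Rightarrow> (fseq \<Rightarrow> fseq \<Rightarrow> fseq) \<Rightarrow> bool" where
  "trilinear d T \<longleftrightarrow>
     (\<forall>u\<in>euclid d. \<forall>v\<in>euclid d. \<forall>w\<in>euclid d.
        inner (T u v) w =
          (\<Sum>i<d. \<Sum>j<d. coord u i * coord v j * inner (T (unit_vec i) (unit_vec j)) w))"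

lemma trilinear_diff:
  assumes "trilinear d S" "trilinear d T"
  shows "trilinear d (\<lambda>u v. S u v - T u v)"
  using assms unfolding trilinear_def
  by (simp add: inner_diff_left sum_subtractf[symmetric] right_diff_distrib)

lemma trilinear_scale:
  assumes "trilinear d T" "u \<in> euclid d" "v \<in> euclid d" "w \<in> euclid d"
  shows "inner (T (a *\<^sub>R u) (b *\<^sub>R v)) (c *\<^sub>R w) = a * b * c * inner (T u v) w"
  using assms unfolding trilinear_def by (simp add: sum_distrib_left mult_ac)

lemma bdd_above_opnorm3:
  assumes T: "trilinear d T"
  shows "bdd_above ((\<lambda>(u, v, w). \<bar>inner (T u v) w\<bar>) `
    (unit_ball d \<times> unit_ball d \<times> unit_ball d))"
proof -
  have "\<bar>inner (T u v) w\<bar> \<le> (\<Sum>i<d. \<Sum>j<d. norm (T (unit_vec i) (unit_vec j)))"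
    if "u \<in> unit_ball d" "v \<in> unit_ball d" "w \<in> unit_ball d" for u v w
  proof -
    have "inner (T u v) w =
        (\<Sum>i<d. \<Sum>j<d. coord u i * coord v j * inner (T (unit_vec i) (unit_vec j)) w)"
      using that T unfolding trilinear_def by auto
    also have "\<bar>\<dots>\<bar> \<le>
        (\<Sum>i<d. \<Sum>j<d. \<bar>coord u i * coord v j * inner (T (unit_vec i) (unit_vec j)) w\<bar>)"
      by (intro order_trans[OF sum_abs] sum_mono sum_abs)
    also have "\<dots> \<le> (\<Sum>i<d. \<Sum>j<d. norm (T (unit_vec i) (unit_vec j)))"
    proof (intro sum_mono)
      fix i j
      have u: "\<bar>coord u i\<bar> \<le> 1" and v: "\<bar>coord v j\<bar> \<le> 1"
        using that abs_coord_le_norm[of u i] abs_coord_le_norm[of v j] by auto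
      have "\<bar>inner (T (unit_vec i) (unit_vec j)) w\<bar> \<le> norm (T (unit_vec i) (unit_vec j)) * norm w"
        by (rule Cauchy_Schwarz_ineq2)
      also have "\<dots> \<le> norm (T (unit_vec i) (unit_vec j))"
        using that by (simp add: mult_left_le)
      finally have "(\<bar>coord u i\<bar> * \<bar>coord v j\<bar>) * \<bar>inner (T (unit_vec i) (unit_vec j)) w\<bar> \<le>
          (1 * 1) * norm (T (unit_vec i) (unit_vec j))"
        using u v by (intro mult_mono) auto
      then show "\<bar>coord u i * coord v j * inner (T (unit_vec i) (unit_vec j)) w\<bar>
          \<le> norm (T (unit_vec i) (unit_vec j))"
        by (simp add: abs_mult)
    qed
    finally show ?thesis .
  qed
  then show ?thesis
    by (intro bdd_aboveI2[where M = "\<Sum>i<d. \<Sum>j<d. norm (T (unit_vec i) (unit_vec j))"])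
      (simp only: split_beta mem_Times_iff)
qed

lemma opnorm3_nonneg: "trilinear d T \<Longrightarrow> 0 \<le> opnorm3 d T"
  unfolding opnorm3_def by (rule cSUP_upper2[OF bdd_above_opnorm3, of _ _ "(0, 0, 0)"]) auto

lemma trilinear_le_opnorm3:
  assumes T: "trilinear d T" and uvw: "u \<in> euclid d" "v \<in> euclid d" "w \<in> euclid d"
  shows "\<bar>inner (T u v) w\<bar> \<le> opnorm3 d T * norm u * norm v * norm w"
proof (cases "u = 0 \<or> v = 0 \<or> w = 0")
  case True
  have "inner (T u v) w = 0"
    using trilinear_scale[OF T uvw, of 0 1 1] trilinear_scale[OF T uvw, of 1 0 1] True by auto
  then show ?thesis
    using True by auto
next
  case False
  from cSUP_upper[OF _ bdd_above_opnorm3[OF T], of "(u /\<^sub>R norm u, v /\<^sub>R norm v, w /\<^sub>R norm w)"]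
  have "\<bar>inner (T (u /\<^sub>R norm u) (v /\<^sub>R norm v)) (w /\<^sub>R norm w)\<bar> \<le> opnorm3 d T"
    unfolding opnorm3_def using unit_ball_normalize uvw by simp
  then show ?thesis
    using False unfolding trilinear_scale[OF T uvw] by (simp add: abs_mult field_simps)
qed

section \<open>Taylor bounds for the gradient and the Hessian of a convex function\<close>

locale smooth_convex =
  fixes d :: nat and f :: "fseq \<Rightarrow> real" and L3 :: real
  assumes convex: "convex_on (euclid d) f"
    and C3: "C3 d f"
    and L3_pos: "0 < L3"
    and third_Lipschitz: "third_deriv_lipschitz d f L3"
begin

lemma grad_in_euclid [simp, intro]: "x \<in> euclid d \<Longrightarrow> grad d f x \<in> euclid d"
  and has_derivative_f:
    "x \<in> euclid d \<Longrightarrow> (f has_derivative inner (grad d f x)) (at x within euclid d)"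
  using C3 has_derivative_grad[of f x d] unfolding C3_def differentiable_on_def by auto

lemma has_derivative_grad_f:
  "x \<in> euclid d \<Longrightarrow> (grad d f has_derivative hess d f x) (at x within euclid d)"
  using C3 unfolding C3_def differentiable_on_def hess_def
  by (simp add: frechet_derivative_works)

lemma has_derivative_hess_f:
  "x \<in> euclid d \<Longrightarrow> u \<in> euclid d \<Longrightarrow>
    ((\<lambda>y. hess d f y u) has_derivative third_deriv d f x u) (at x within euclid d)"
  using C3 unfolding C3_def differentiable_on_def third_deriv_def
  by (simp add: frechet_derivative_works)

lemma linear_hess: "x \<in> euclid d \<Longrightarrow> linear (hess d f x)"
  using has_derivative_linear[OF has_derivative_grad_f] .

lemma DERIV_f:
  "x \<in> euclid d \<Longrightarrow> h \<in> euclid d \<Longrightarrow>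
    ((\<lambda>s. f (x + s *\<^sub>R h)) has_real_derivative inner (grad d f (x + s *\<^sub>R h)) h) (at s)"
  by (rule DERIV_line[OF has_derivative_f]) auto

lemma DERIV_grad_f:
  "x \<in> euclid d \<Longrightarrow> h \<in> euclid d \<Longrightarrow>
    ((\<lambda>s. inner (grad d f (x + s *\<^sub>R h)) w) has_real_derivative
      inner (hess d f (x + s *\<^sub>R h) h) w) (at s)"
  by (rule DERIV_line_inner[OF has_derivative_grad_f]) auto

lemma DERIV_hess_f:
  "x \<in> euclid d \<Longrightarrow> h \<in> euclid d \<Longrightarrow> u \<in> euclid d \<Longrightarrow>
    ((\<lambda>s. inner (hess d f (x + s *\<^sub>R h) u) w) has_real_derivative
      inner (third_deriv d f (x + s *\<^sub>R h) u h) w) (at s)"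
  by (rule DERIV_line_inner[OF has_derivative_hess_f]) auto

text \<open>Linearity in \<open>v\<close> is that of a derivative. For \<open>u\<close>, the Hessian
  at every point of the line in direction \<open>v\<close> is expanded in unit vectors, the
  expansion is differentiated term by term, and uniqueness of derivatives identifies the
  result.\<close>

lemma trilinear_third_deriv:
  assumes x: "x \<in> euclid d"
  shows "trilinear d (third_deriv d f x)"
  unfolding trilinear_def
proof (intro ballI)
  fix u v w assume u: "u \<in> euclid d" and v: "v \<in> euclid d"
  have "((\<lambda>s. \<Sum>i<d. coord u i * inner (hess d f (x + s *\<^sub>R v) (unit_vec i)) w) has_real_derivative
      (\<Sum>i<d. coord u i * inner (third_deriv d f (x + 0 *\<^sub>R v) (unit_vec i) v) w)) (at 0)"
    by (intro DERIV_sum DERIV_cmult DERIV_hess_f x v) (simp add: unit_vec_in_euclid)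
  moreover have "(\<Sum>i<d. coord u i * inner (hess d f (x + s *\<^sub>R v) (unit_vec i)) w) =
      inner (hess d f (x + s *\<^sub>R v) u) w" for s
    using linear_euclid_expansion[OF linear_hess u, of "x + s *\<^sub>R v"] x v
    by (simp add: inner_sum_left)
  ultimately have "inner (third_deriv d f x u v) w =
      (\<Sum>i<d. coord u i * inner (third_deriv d f x (unit_vec i) v) w)"
    using DERIV_unique[OF DERIV_hess_f[OF x v u, where s = 0 and w = w]] by simp
  also have "\<dots> = (\<Sum>i<d. \<Sum>j<d. coord u i * coord v j *
      inner (third_deriv d f x (unit_vec i) (unit_vec j)) w)"
  proof (rule sum.cong)
    fix i assume "i \<in> {..<d}"
    then have "linear (third_deriv d f x (unit_vec i))"
      by (intro has_derivative_linear[OF has_derivative_hess_f] x unit_vec_in_euclid) simp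
    from linear_euclid_expansion[OF this v]
    show "coord u i * inner (third_deriv d f x (unit_vec i) v) w = (\<Sum>j<d. coord u i * coord v j *
        inner (third_deriv d f x (unit_vec i) (unit_vec j)) w)"
      by (simp add: inner_sum_left sum_distrib_left mult.assoc)
  qed simp
  finally show "inner (third_deriv d f x u v) w = (\<Sum>i<d. \<Sum>j<d. coord u i * coord v j *
      inner (third_deriv d f x (unit_vec i) (unit_vec j)) w)" .
qed

lemma third_deriv_diff_le:
  assumes "x \<in> euclid d" "y \<in> euclid d" "u \<in> euclid d" "v \<in> euclid d" "w \<in> euclid d"
  shows "\<bar>inner (third_deriv d f x u v) w - inner (third_deriv d f y u v) w\<bar>
    \<le> L3 * norm (x - y) * norm u * norm v * norm w"
proof -
  let ?T = "\<lambda>u v. third_deriv d f x u v - third_deriv d f y u v"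
  have "\<bar>inner (?T u v) w\<bar> \<le> opnorm3 d ?T * norm u * norm v * norm w"
    using assms by (intro trilinear_le_opnorm3 trilinear_diff trilinear_third_deriv)
  also have "\<dots> \<le> L3 * norm (x - y) * norm u * norm v * norm w"
    using third_Lipschitz assms unfolding third_deriv_lipschitz_def
    by (intro mult_right_mono) auto
  finally show ?thesis
    by (simp add: inner_diff_left)
qed

lemma hess_taylor:
  assumes x: "x \<in> euclid d" and h: "h \<in> euclid d" and u: "u \<in> euclid d" and w: "w \<in> euclid d"
  shows "\<bar>inner (hess d f (x + h) u) w - inner (hess d f x u) w - inner (third_deriv d f x u h) w\<bar>
    \<le> L3 / 2 * (norm h)\<^sup>2 * norm u * norm w"
proof -
  define K where "K = L3 * (norm h)\<^sup>2 * norm u * norm w"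
  have "\<bar>inner (hess d f (x + 1 *\<^sub>R h) u) w - inner (hess d f (x + 0 *\<^sub>R h) u) w -
      inner (third_deriv d f (x + 0 *\<^sub>R h) u h) w\<bar> \<le> K / 2"
  proof (rule taylor_Lipschitz_derivative)
    show "((\<lambda>s. inner (hess d f (x + s *\<^sub>R h) u) w) has_real_derivative
        inner (third_deriv d f (x + s *\<^sub>R h) u h) w) (at s)" for s
      by (rule DERIV_hess_f[OF x h u])
    show "\<bar>inner (third_deriv d f (x + s *\<^sub>R h) u h) w - inner (third_deriv d f (x + 0 *\<^sub>R h) u h) w\<bar>
        \<le> K * s" if "0 \<le> s" for s
      using third_deriv_diff_le[of "x + s *\<^sub>R h" x u h w] assms that
      by (auto simp: K_def power2_eq_square mult_ac)
  qed
  then show ?thesis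
    by (simp add: K_def)
qed

text \<open>Second order Taylor expansion at \<open>x0\<close>. It is through this bound that the
  derivatives at \<open>x0\<close> control the Hessian at query points and iterates.\<close>

lemma hess_le:
  assumes x: "x0 \<in> euclid d" "x \<in> euclid d" and u: "u \<in> euclid d" and w: "w \<in> euclid d"
    and D: "norm (x - x0) \<le> D"
  shows "\<bar>inner (hess d f x u) w\<bar> \<le>
    (opnorm2 d (hess d f x0) + opnorm3 d (third_deriv d f x0) * D + L3 / 2 * D\<^sup>2) * norm u * norm w"
proof -
  have h: "x - x0 \<in> euclid d"
    using x by auto
  have "\<bar>inner (hess d f x0 u) w\<bar> \<le> norm (hess d f x0 u) * norm w"
    by (rule Cauchy_Schwarz_ineq2)
  also have "\<dots> \<le> opnorm2 d (hess d f x0) * norm u * norm w"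
    by (intro mult_right_mono linear_le_opnorm2 linear_hess x u) auto
  finally have 1: "\<bar>inner (hess d f x0 u) w\<bar> \<le> opnorm2 d (hess d f x0) * norm u * norm w" .
  have "\<bar>inner (third_deriv d f x0 u (x - x0)) w\<bar>
      \<le> opnorm3 d (third_deriv d f x0) * norm u * norm (x - x0) * norm w"
    by (intro trilinear_le_opnorm3 trilinear_third_deriv x u h w)
  also have "\<dots> \<le> opnorm3 d (third_deriv d f x0) * norm u * D * norm w"
    using D by (intro mult_right_mono mult_left_mono mult_nonneg_nonneg opnorm3_nonneg
        trilinear_third_deriv x) auto
  finally have 2: "\<bar>inner (third_deriv d f x0 u (x - x0)) w\<bar>
      \<le> opnorm3 d (third_deriv d f x0) * D * norm u * norm w"
    by (simp add: mult_ac)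
  have "\<bar>inner (hess d f x u) w - inner (hess d f x0 u) w - inner (third_deriv d f x0 u (x - x0)) w\<bar>
      \<le> L3 / 2 * (norm (x - x0))\<^sup>2 * norm u * norm w"
    using hess_taylor[OF x(1) h u w] by simp
  also have "\<dots> \<le> L3 / 2 * D\<^sup>2 * norm u * norm w"
    using D L3_pos by (intro mult_right_mono mult_left_mono power_mono) auto
  finally have "\<bar>inner (hess d f x u) w\<bar> \<le> opnorm2 d (hess d f x0) * norm u * norm w +
      opnorm3 d (third_deriv d f x0) * D * norm u * norm w + L3 / 2 * D\<^sup>2 * norm u * norm w"
    using 1 2 by linarith
  then show ?thesis
    by (simp add: distrib_right)
qed

lemma tangent_le:
  assumes "x \<in> euclid d" "y \<in> euclid d"
  shows "f x + inner (grad d f x) (y - x) \<le> f y"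
proof -
  have "convex_on UNIV (\<lambda>s. f (x + s *\<^sub>R (y - x)))"
  proof (rule convex_onI)
    fix t a b :: real assume "0 < t" "t < 1"
    moreover have "x + ((1 - t) *\<^sub>R a + t *\<^sub>R b) *\<^sub>R (y - x) =
        (1 - t) *\<^sub>R (x + a *\<^sub>R (y - x)) + t *\<^sub>R (x + b *\<^sub>R (y - x))"
      by (simp add: algebra_simps)
    ultimately show "f (x + ((1 - t) *\<^sub>R a + t *\<^sub>R b) *\<^sub>R (y - x)) \<le>
        (1 - t) * f (x + a *\<^sub>R (y - x)) + t * f (x + b *\<^sub>R (y - x))"
      using assms by (auto intro!: convex_onD[OF convex])
  qed simp
  from convex_on_imp_above_tangent[OF this, of 0 1 "inner (grad d f x) (y - x)"]
    DERIV_f[of x "y - x" 0] assms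
  show ?thesis
    by simp
qed

lemma grad_monotone:
  assumes "x \<in> euclid d" "y \<in> euclid d"
  shows "0 \<le> inner (grad d f y - grad d f x) (y - x)"
  using tangent_le[of x y] tangent_le[of y x] assms by (simp add: algebra_simps)

text \<open>Otherwise the gradient tested with \<open>u\<close> would decrease strictly for a short
  step along \<open>u\<close>, against its monotonicity.\<close>

lemma hess_nonneg:
  assumes x: "x \<in> euclid d" and u: "u \<in> euclid d"
  shows "0 \<le> inner (hess d f x u) u"
proof (rule ccontr)
  assume neg: "\<not> 0 \<le> inner (hess d f x u) u"
  have "((\<lambda>s. inner (grad d f (x + s *\<^sub>R u)) u) has_real_derivative inner (hess d f x u) u) (at 0)"
    using DERIV_grad_f[OF x u, where s = 0] by simp
  from DERIV_neg_dec_right[OF this] neg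
  obtain e where e: "e > 0"
    "\<And>t. 0 < t \<Longrightarrow> t < e \<Longrightarrow> inner (grad d f (x + t *\<^sub>R u)) u < inner (grad d f x) u"
    by auto
  have "0 \<le> inner (grad d f (x + (e / 2) *\<^sub>R u) - grad d f x) ((e / 2) *\<^sub>R u)"
    using grad_monotone[of x "x + (e / 2) *\<^sub>R u"] x u by auto
  then have "0 \<le> inner (grad d f (x + (e / 2) *\<^sub>R u) - grad d f x) u"
    using e(1) by (simp add: zero_le_mult_iff)
  then show False
    using e(2)[of "e / 2"] e(1) by (simp add: inner_diff_left)
qed

text \<open>Positivity of the Hessian at \<open>z + \<xi> h\<close> and \<open>z - \<xi> h\<close> bounds the third derivative along \<open>h\<close>
  by the Hessian at \<open>z\<close> up to a quadratic error.\<close>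

lemma hess_sandwich:
  assumes "z \<in> euclid d" "h \<in> euclid d" "u \<in> euclid d" "0 < \<xi>"
  shows "inner (hess d f (z + h) u) u \<le>
      (1 + 1 / \<xi>) * inner (hess d f z u) u + (1 + \<xi>) * (L3 / 2 * (norm h)\<^sup>2 * (norm u)\<^sup>2)"
    and "(1 - 1 / \<xi>) * inner (hess d f z u) u - (1 + \<xi>) * (L3 / 2 * (norm h)\<^sup>2 * (norm u)\<^sup>2) \<le>
      inner (hess d f (z + h) u) u"
proof -
  define a b l where "a = inner (hess d f z u) u" "b = inner (third_deriv d f z u h) u"
    "l = L3 / 2 * (norm h)\<^sup>2 * (norm u)\<^sup>2"
  note abl = this
  have taylor: "\<bar>inner (hess d f (z + s *\<^sub>R h) u) u - a - s * b\<bar> \<le> s\<^sup>2 * l" for s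
  proof -
    have "linear (third_deriv d f z u)"
      using assms by (intro has_derivative_linear[OF has_derivative_hess_f])
    then have "inner (third_deriv d f z u (s *\<^sub>R h)) u = s * b"
      by (simp add: abl linear_scale)
    then show ?thesis
      using hess_taylor[of z "s *\<^sub>R h" u u] assms
      by (simp add: abl power_mult_distrib power2_eq_square mult_ac)
  qed
  have "0 \<le> inner (hess d f (z + s *\<^sub>R h) u) u" for s
    using assms by (intro hess_nonneg) auto
  from this[of \<xi>] this[of "- \<xi>"] taylor[of \<xi>] taylor[of "- \<xi>"]
  have "\<xi> * \<bar>b\<bar> \<le> a + \<xi>\<^sup>2 * l"
    by (auto simp: abs_if split: if_splits)
  then have b: "\<bar>b\<bar> \<le> a / \<xi> + \<xi> * l"
    using assms(4) by (simp add: field_simps power2_eq_square)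
  have *: "(1 + 1 / \<xi>) * a + (1 + \<xi>) * l = a + a / \<xi> + \<xi> * l + l"
    "(1 - 1 / \<xi>) * a - (1 + \<xi>) * l = a - a / \<xi> - \<xi> * l - l"
    by (simp_all add: algebra_simps)
  have "inner (hess d f (z + h) u) u \<le> (1 + 1 / \<xi>) * a + (1 + \<xi>) * l"
    using taylor[of 1] b unfolding * by simp
  moreover have "(1 - 1 / \<xi>) * a - (1 + \<xi>) * l \<le> inner (hess d f (z + h) u) u"
    using taylor[of 1] b unfolding * by simp
  ultimately show "inner (hess d f (z + h) u) u \<le>
      (1 + 1 / \<xi>) * inner (hess d f z u) u + (1 + \<xi>) * (L3 / 2 * (norm h)\<^sup>2 * (norm u)\<^sup>2)"
    and "(1 - 1 / \<xi>) * inner (hess d f z u) u - (1 + \<xi>) * (L3 / 2 * (norm h)\<^sup>2 * (norm u)\<^sup>2) \<le>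
      inner (hess d f (z + h) u) u"
    by (simp_all add: abl)
qed

text \<open>Testing the gradient with its own increment \<open>w\<close> makes the function scalar,
  so the mean value theorem applies; one factor \<open>norm w\<close> then cancels.\<close>

lemma grad_Lipschitz:
  assumes x: "x \<in> euclid d" and y: "y \<in> euclid d"
    and B: "\<And>p u w. p \<in> closed_segment x y \<Longrightarrow> u \<in> euclid d \<Longrightarrow> w \<in> euclid d \<Longrightarrow>
      \<bar>inner (hess d f p u) w\<bar> \<le> B * norm u * norm w"
  shows "norm (grad d f y - grad d f x) \<le> B * norm (y - x)"
proof -
  define w where "w = grad d f y - grad d f x"
  have w: "w \<in> euclid d" and u: "y - x \<in> euclid d"
    using x y by (auto simp: w_def)
  let ?p = "\<lambda>s. inner (grad d f (x + s *\<^sub>R (y - x))) w"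
  obtain s where s: "0 < s" "s < 1"
    "?p 1 - ?p 0 = (1 - 0) * inner (hess d f (x + s *\<^sub>R (y - x)) (y - x)) w"
    using MVT2[of 0 1 ?p "\<lambda>s. inner (hess d f (x + s *\<^sub>R (y - x)) (y - x)) w"]
      DERIV_grad_f[OF x u] by auto
  have "x + s *\<^sub>R (y - x) \<in> closed_segment x y"
    unfolding closed_segment_def using s by (auto intro!: exI[of _ s] simp: algebra_simps)
  from B[OF this u w] s(3) have "norm w * norm w \<le> norm w * (B * norm (y - x))"
    by (simp add: w_def inner_diff_left[symmetric] power2_norm_eq_inner[symmetric]
        power2_eq_square mult_ac)
  then have "norm w \<le> B * norm (y - x)" if "w \<noteq> 0"
    using that by simp
  \<comment> \<open>No sign of \<open>B\<close> is assumed; it is forced by the Hessian bound in the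
    direction \<open>y - x\<close>.\<close>
  moreover have "0 \<le> B * norm (y - x)" if "w = 0"
  proof (cases "x = y")
    case False
    have "\<bar>inner (hess d f x (y - x)) (y - x)\<bar> \<le> B * norm (y - x) * norm (y - x)"
      using B[of x] u by simp
    then have "0 \<le> B * norm (y - x) * norm (y - x)"
      using order_trans abs_ge_zero by blast
    then show ?thesis
      using False by (simp add: zero_le_mult_iff)
  qed simp
  ultimately show ?thesis
    by (fastforce simp: w_def)
qed

end

section \<open>The Bregman distance gradient method\<close>

text \<open>The map is the gradient of the fourth power of the norm divided by 4. Splitting off
  \<open>a - b\<close> and the difference of the squared norms gives the constant as one plus two
  times \<open>D\<^sup>2\<close>.\<close>

lemma norm_cube_Lipschitz:
  fixes a b :: "'a :: real_inner"
  assumes "norm a \<le> D" "norm b \<le> D"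
  shows "norm ((norm a)\<^sup>2 *\<^sub>R a - (norm b)\<^sup>2 *\<^sub>R b) \<le> 3 * D\<^sup>2 * norm (a - b)"
proof -
  have D: "0 \<le> D"
    using assms(1) norm_ge_zero order_trans by blast
  have "(norm a)\<^sup>2 *\<^sub>R a - (norm b)\<^sup>2 *\<^sub>R b = (norm a)\<^sup>2 *\<^sub>R (a - b) + ((norm a)\<^sup>2 - (norm b)\<^sup>2) *\<^sub>R b"
    by (simp add: algebra_simps)
  then have "norm ((norm a)\<^sup>2 *\<^sub>R a - (norm b)\<^sup>2 *\<^sub>R b) \<le>
      (norm a)\<^sup>2 * norm (a - b) + \<bar>(norm a)\<^sup>2 - (norm b)\<^sup>2\<bar> * norm b"
    using norm_triangle_ineq[of "(norm a)\<^sup>2 *\<^sub>R (a - b)" "((norm a)\<^sup>2 - (norm b)\<^sup>2) *\<^sub>R b"] by simp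
  also have "\<bar>(norm a)\<^sup>2 - (norm b)\<^sup>2\<bar> = (norm a + norm b) * \<bar>norm a - norm b\<bar>"
    by (simp add: power2_eq_square square_diff_square_factored abs_mult)
  also have "(norm a)\<^sup>2 * norm (a - b) + (norm a + norm b) * \<bar>norm a - norm b\<bar> * norm b \<le>
      D\<^sup>2 * norm (a - b) + (D + D) * norm (a - b) * D"
    using assms D by (intro add_mono mult_mono power_mono norm_triangle_ineq3) auto
  finally show ?thesis
    by (simp add: power2_eq_square algebra_simps)
qed

locale convex_bdgm = bdgm d f H \<delta> L3 \<xi> + smooth_convex d f L3
  for d :: nat and f :: "fseq \<Rightarrow> real" and H :: "fseq \<Rightarrow> fseq \<Rightarrow> fseq" and \<delta> L3 \<xi> :: real +
  assumes \<xi>: "1 < \<xi>" and \<delta>: "0 < \<delta>" and H: "hessian_estimator d f \<delta> H"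
begin

lemma linear_H: "z \<in> euclid d \<Longrightarrow> linear (H z)"
  and H_in_euclid: "z \<in> euclid d \<Longrightarrow> u \<in> euclid d \<Longrightarrow> H z u \<in> euclid d"
  and H_symmetric:
    "z \<in> euclid d \<Longrightarrow> u \<in> euclid d \<Longrightarrow> v \<in> euclid d \<Longrightarrow> inner (H z u) v = inner u (H z v)"
  using H unfolding hessian_estimator_def by blast+

lemma H_form:
  assumes "z \<in> euclid d" "u \<in> euclid d"
  shows "\<bar>inner (H z u) u - inner (hess d f z u) u\<bar> \<le> \<delta> * (norm u)\<^sup>2"
proof -
  have "\<bar>inner (H z u - hess d f z u) u\<bar> \<le> norm (H z u - hess d f z u) * norm u"
    by (rule Cauchy_Schwarz_ineq2)
  also have "norm (H z u - hess d f z u) \<le> opnorm2 d (\<lambda>h. H z h - hess d f z h) * norm u"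
    using assms by (intro linear_le_opnorm2 linear_compose_sub linear_H linear_hess)
  also have "opnorm2 d (\<lambda>h. H z h - hess d f z h) \<le> \<delta>"
    using H assms unfolding hessian_estimator_def by blast
  finally show ?thesis
    by (simp add: inner_diff_left power2_eq_square mult_right_mono mult_ac)
qed

text \<open>The strong convexity constant of \<open>reg_obj z\<close> relative to
  \<open>ref_fun z\<close>. It equals \<open>\<theta> * (1 - 1 / \<xi>)\<close> for the weight
  \<open>\<theta> = \<xi> / (2 * \<xi> + 1)\<close>, at which the quartic terms balance in the
  comparison of the Hessian forms.\<close>

definition \<mu> :: real where
  "\<mu> = (\<xi> - 1) / (2 * \<xi> + 1)"

text \<open>The value of \<open>lam z\<close> at \<open>z\<close> itself, which is also the modulus
  of the quadratic regularizer in \<open>reg_obj z\<close>.\<close>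

definition lam_min :: real where
  "lam_min = (\<xi>\<^sup>2 - 1) / \<xi> * \<delta>"

text \<open>One minus the ratio of the relative strong convexity constant to the coefficient of the
  Bregman distance in \<open>step\<close>.\<close>

definition rate :: real where
  "rate = 1 - \<mu> / (2 * (1 + 1 / \<xi>))"

lemma \<mu>_pos: "0 < \<mu>"
  using \<xi> by (simp add: \<mu>_def)

lemma \<xi>_nonzero: "\<xi> \<noteq> 0"
  using \<xi> by simp

lemma \<xi>_square: "1 < \<xi>\<^sup>2"
  using \<xi> by simp

lemma lam_min_pos: "0 < lam_min"
  using \<xi> \<xi>_square \<delta> by (simp add: lam_min_def)

lemma lam_min_le: "lam_min \<le> lam z y"
  using \<xi> L3_pos by (simp add: lam_min_def lam_def)

lemma lam_pos: "0 < lam z y"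
  using lam_min_pos lam_min_le by (rule less_le_trans)

text \<open>The gradient of \<open>reg_obj z\<close>, and at the same time the vector whose norm
  \<open>MS\<close> tests. So the MS condition says that \<open>y\<close> is nearly stationary for
  \<open>reg_obj z\<close>, measured against \<open>lam z y * norm (y - z)\<close>.\<close>

definition reg_grad :: "fseq \<Rightarrow> fseq \<Rightarrow> fseq" where
  "reg_grad z y = grad d f y + lam z y *\<^sub>R (y - z)"

definition ref_grad :: "fseq \<Rightarrow> fseq \<Rightarrow> fseq" where
  "ref_grad z y = H z (y - z) + (\<xi> * \<delta>) *\<^sub>R (y - z)
     + ((\<xi> + \<xi>\<^sup>2) * L3 / 3 * (norm (y - z))\<^sup>2) *\<^sub>R (y - z)"

lemma reg_grad_in_euclid: "z \<in> euclid d \<Longrightarrow> y \<in> euclid d \<Longrightarrow> reg_grad z y \<in> euclid d"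
  by (auto simp: reg_grad_def)

lemma ref_grad_in_euclid: "z \<in> euclid d \<Longrightarrow> y \<in> euclid d \<Longrightarrow> ref_grad z y \<in> euclid d"
  by (auto simp: ref_grad_def H_in_euclid)

lemma norm_power4: "norm x ^ 4 = (inner x x)\<^sup>2" for x :: fseq
  by (simp add: power2_norm_eq_inner[symmetric] flip: power_mult)

lemma has_derivative_reg_obj:
  assumes "z \<in> euclid d" "y \<in> euclid d"
  shows "(reg_obj z has_derivative inner (reg_grad z y)) (at y within euclid d)"
proof (rule has_derivative_gradientI)
  show "(reg_obj z has_derivative (\<lambda>h. inner (grad d f y) h
      + (\<xi>\<^sup>2 - 1) * \<delta> / (2 * \<xi>) * (2 * inner (y - z) h)
      + (1 + \<xi>) * \<xi> * L3 / 24 * (2 * inner (y - z) (y - z) * (2 * inner (y - z) h))))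
      (at y within euclid d)"
    unfolding reg_obj_def[abs_def] norm_power4 power2_norm_eq_inner
    by (auto intro!: derivative_eq_intros has_derivative_f assms simp: inner_commute \<xi>_nonzero)
next
  fix h
  show "inner (grad d f y) h + (\<xi>\<^sup>2 - 1) * \<delta> / (2 * \<xi>) * (2 * inner (y - z) h)
      + (1 + \<xi>) * \<xi> * L3 / 24 * (2 * inner (y - z) (y - z) * (2 * inner (y - z) h))
      = inner (reg_grad z y) h"
    unfolding reg_grad_def lam_def inner_add_left inner_scaleR_left power2_norm_eq_inner
    using \<xi>_nonzero by (simp add: field_simps)
qed (use assms in auto)

lemma has_derivative_ref_fun:
  assumes z: "z \<in> euclid d" and y: "y \<in> euclid d"
  shows "(ref_fun z has_derivative inner (ref_grad z y)) (at y within euclid d)"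
proof (rule has_derivative_gradientI)
  \<comment> \<open>\<open>H z\<close> may be unbounded on the ambient type, so its truncation is
    differentiated instead; both agree on \<open>euclid d\<close>. Symmetry of \<open>H z\<close>
    then merges the two terms of the product rule.\<close>
  let ?T = "truncate d (H z)"
  have T: "?T u = H z u" if "u \<in> euclid d" for u
    using truncate_eq[OF linear_H[OF z] that] .
  let ?D = "\<lambda>h. 1/2 * (inner (?T (y - z) + (\<xi> * \<delta>) *\<^sub>R (y - z)) h + inner (?T h + (\<xi> * \<delta>) *\<^sub>R h) (y - z))
      + (\<xi> + \<xi>\<^sup>2) * L3 / 12 * (2 * inner (y - z) (y - z) * (2 * inner (y - z) h))"
  have "((\<lambda>y. 1/2 * inner (?T (y - z) + (\<xi> * \<delta>) *\<^sub>R (y - z)) (y - z)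
      + (\<xi> + \<xi>\<^sup>2) * L3 / 12 * (inner (y - z) (y - z))\<^sup>2) has_derivative ?D) (at y within euclid d)"
    by (auto intro!: derivative_eq_intros bounded_linear.has_derivative[OF bounded_linear_truncate]
        simp: inner_commute)
  then show "(ref_fun z has_derivative ?D) (at y within euclid d)"
    by (rule has_derivative_transform[OF y, rotated])
      (use z T in \<open>auto simp: ref_fun_def norm_power4\<close>)
  fix h assume h: "h \<in> euclid d"
  define v where "v = y - z"
  have v: "v \<in> euclid d"
    using y z by (auto simp: v_def)
  have [simp]: "inner (H z h) v = inner (H z v) h" "inner h v = inner v h"
    using H_symmetric[OF z h v] by (simp_all only: inner_commute)
  show "?D h = inner (ref_grad z y) h"
    unfolding ref_grad_def v_def[symmetric] power2_norm_eq_inner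
    by (simp add: T h v inner_add_left field_simps)
qed (use assms in auto)

lemma grad_reg_obj: "z \<in> euclid d \<Longrightarrow> y \<in> euclid d \<Longrightarrow> grad d (reg_obj z) y = reg_grad z y"
  by (intro grad_eqI has_derivative_reg_obj reg_grad_in_euclid)

lemma grad_ref_fun: "z \<in> euclid d \<Longrightarrow> y \<in> euclid d \<Longrightarrow> grad d (ref_fun z) y = ref_grad z y"
  by (intro grad_eqI has_derivative_ref_fun ref_grad_in_euclid)

section \<open>Hessian forms and their comparison\<close>

text \<open>\<open>reg_form z x\<close> and \<open>ref_form z x\<close> are the quadratic forms of the Hessians of \<open>reg_obj z\<close> and
  \<open>ref_fun z\<close> at \<open>x\<close>.\<close>

definition quartic_form :: "fseq \<Rightarrow> fseq \<Rightarrow> real" where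
  "quartic_form h u = (norm h)\<^sup>2 * (norm u)\<^sup>2 + 2 * (inner h u)\<^sup>2"

definition reg_form :: "fseq \<Rightarrow> fseq \<Rightarrow> fseq \<Rightarrow> real" where
  "reg_form z x u = inner (hess d f x u) u + lam_min * (norm u)\<^sup>2
     + (1 + \<xi>) * \<xi> * L3 / 6 * quartic_form (x - z) u"

definition ref_form :: "fseq \<Rightarrow> fseq \<Rightarrow> fseq \<Rightarrow> real" where
  "ref_form z x u = inner (H z u) u + \<xi> * \<delta> * (norm u)\<^sup>2
     + (\<xi> + \<xi>\<^sup>2) * L3 / 3 * quartic_form (x - z) u"

text \<open>The vector \<open>(norm h)\<^sup>2 *\<^sub>R h\<close> is the gradient of the fourth
  power of the norm divided by 4, so \<open>quartic_form h\<close> is the corresponding Hessian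
  form. Along a line both sides are polynomials in \<open>s\<close>.\<close>

lemma DERIV_quartic:
  "((\<lambda>s. (norm (h + s *\<^sub>R u))\<^sup>2 * inner (h + s *\<^sub>R u) u) has_real_derivative
     quartic_form (h + s *\<^sub>R u) u) (at s)"
proof -
  have [simp]: "inner u h = inner h u"
    by (rule inner_commute)
  have "((\<lambda>s. (inner h h + 2 * s * inner h u + s\<^sup>2 * inner u u) * (inner h u + s * inner u u))
      has_real_derivative (2 * inner h u + 2 * s * inner u u) * (inner h u + s * inner u u) +
        (inner h h + 2 * s * inner h u + s\<^sup>2 * inner u u) * inner u u) (at s)"
    by (auto intro!: derivative_eq_intros)
  moreover have "(norm (h + t *\<^sub>R u))\<^sup>2 * inner (h + t *\<^sub>R u) u =
      (inner h h + 2 * t * inner h u + t\<^sup>2 * inner u u) * (inner h u + t * inner u u)" for t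
    unfolding power2_norm_eq_inner
    by (simp add: inner_add_left inner_add_right power2_eq_square algebra_simps)
  moreover have "quartic_form (h + s *\<^sub>R u) u =
      (2 * inner h u + 2 * s * inner u u) * (inner h u + s * inner u u) +
        (inner h h + 2 * s * inner h u + s\<^sup>2 * inner u u) * inner u u"
    unfolding quartic_form_def power2_norm_eq_inner
    by (simp add: inner_add_left inner_add_right power2_eq_square algebra_simps)
  ultimately show ?thesis
    by simp
qed

lemma DERIV_inner_line:
  "((\<lambda>s. inner (h + s *\<^sub>R u) w) has_real_derivative inner u w) (at s)" for h u w :: fseq
  unfolding inner_add_left inner_scaleR_left by (auto intro!: derivative_eq_intros)

lemma DERIV_reg_grad:
  assumes x: "x \<in> euclid d" and u: "u \<in> euclid d"
  shows "((\<lambda>s. inner (reg_grad z (x + s *\<^sub>R u)) u) has_real_derivative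
    reg_form z (x + s *\<^sub>R u) u) (at s)"
proof -
  let ?h = "x - z"
  let ?F = "\<lambda>s. inner (grad d f (x + s *\<^sub>R u)) u + lam_min * inner (?h + s *\<^sub>R u) u +
      (1 + \<xi>) * \<xi> * L3 / 6 * ((norm (?h + s *\<^sub>R u))\<^sup>2 * inner (?h + s *\<^sub>R u) u)"
  have "(?F has_real_derivative inner (hess d f (x + s *\<^sub>R u) u) u + lam_min * inner u u +
      (1 + \<xi>) * \<xi> * L3 / 6 * quartic_form (?h + s *\<^sub>R u) u) (at s)"
    by (intro DERIV_add DERIV_grad_f DERIV_cmult DERIV_quartic DERIV_inner_line x u)
  moreover have shift: "x + t *\<^sub>R u - z = ?h + t *\<^sub>R u" for t
    by simp
  moreover have "inner (reg_grad z (x + t *\<^sub>R u)) u = ?F t" for t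
    unfolding reg_grad_def lam_def lam_min_def shift inner_add_left[of "grad _ _ _"]
      inner_scaleR_left by (simp only: distrib_right mult.assoc add.assoc)
  ultimately show ?thesis
    unfolding reg_form_def shift by (simp only: power2_norm_eq_inner)
qed

lemma DERIV_ref_grad:
  assumes z: "z \<in> euclid d"
  shows "((\<lambda>s. inner (ref_grad z (x + s *\<^sub>R u)) u) has_real_derivative
    ref_form z (x + s *\<^sub>R u) u) (at s)"
proof -
  let ?h = "x - z"
  let ?F = "\<lambda>s. inner (H z ?h + s *\<^sub>R H z u) u + \<xi> * \<delta> * inner (?h + s *\<^sub>R u) u +
      (\<xi> + \<xi>\<^sup>2) * L3 / 3 * ((norm (?h + s *\<^sub>R u))\<^sup>2 * inner (?h + s *\<^sub>R u) u)"
  have "(?F has_real_derivative inner (H z u) u + \<xi> * \<delta> * inner u u +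
      (\<xi> + \<xi>\<^sup>2) * L3 / 3 * quartic_form (?h + s *\<^sub>R u) u) (at s)"
    by (intro DERIV_add DERIV_cmult DERIV_quartic DERIV_inner_line)
  moreover have shift: "x + t *\<^sub>R u - z = ?h + t *\<^sub>R u" for t
    by simp
  moreover have "H z (?h + t *\<^sub>R u) = H z ?h + t *\<^sub>R H z u" for t
    using linear_H[OF z] by (simp only: linear_add linear_scale)
  then have "inner (ref_grad z (x + t *\<^sub>R u)) u = ?F t" for t
    unfolding ref_grad_def shift inner_add_left[of "_ + _ *\<^sub>R (_ + _)"]
    by (simp only: inner_add_left[of "H z _ + _ *\<^sub>R H z _"] inner_scaleR_left[of _ "_ + _"] mult.assoc)
  ultimately show ?thesis
    unfolding ref_form_def shift by (simp only: power2_norm_eq_inner)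
qed

text \<open>The upper Hessian bound is combined with the estimator error. The quadratic terms match
  exactly, because \<open>lam_min\<close> is \<open>(1 + 1 / \<xi>) * (\<xi> - 1) * \<delta>\<close>
  and the estimator error supplies the missing \<open>(1 + 1 / \<xi>) * \<delta>\<close>. For the
  quartic terms it remains that \<open>1/2 + \<xi>/6 \<le> (1 + \<xi>)/3\<close>, which holds since
  \<xi> is at least 1.\<close>

lemma reg_form_le_ref_form:
  assumes z: "z \<in> euclid d" and x: "x \<in> euclid d" and u: "u \<in> euclid d"
  shows "reg_form z x u \<le> (1 + 1 / \<xi>) * ref_form z x u"
proof -
  define N U W a k where "N = (norm (x - z))\<^sup>2 * (norm u)\<^sup>2" "U = \<delta> * (norm u)\<^sup>2"
    "W = (inner (x - z) u)\<^sup>2" "a = inner (hess d f z u) u" "k = 1 / \<xi>"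
  note defs = this
  have k: "k * \<xi> = 1" "0 < k"
    using \<xi> by (auto simp: defs)
  have nonneg: "0 \<le> N" "0 \<le> W"
    by (auto simp: defs)
  have "inner (hess d f x u) u \<le> (1 + k) * a + (1 + \<xi>) * (L3 / 2 * N)"
    using hess_sandwich(1)[of z "x - z" u \<xi>] assms \<xi> by (simp add: defs mult_ac)
  moreover have "(1 + k) * a \<le> (1 + k) * (inner (H z u) u + U)"
    using H_form[OF z u] k by (intro mult_left_mono) (auto simp: defs)
  moreover have "lam_min * (norm u)\<^sup>2 = (1 + k) * (\<xi> - 1) * U"
    using \<xi> by (simp add: lam_min_def defs field_simps power2_eq_square)
  moreover have "reg_form z x u =
      inner (hess d f x u) u + lam_min * (norm u)\<^sup>2 + (1 + \<xi>) * \<xi> * L3 / 6 * (N + 2 * W)"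
    by (simp add: reg_form_def quartic_form_def defs)
  ultimately have "reg_form z x u \<le> (1 + k) * (inner (H z u) u + U) + (1 + k) * (\<xi> - 1) * U +
      (1 + \<xi>) * (L3 / 2 * N) + (1 + \<xi>) * \<xi> * L3 / 6 * (N + 2 * W)"
    by linarith
  also have "\<dots> = (1 + k) * (inner (H z u) u + \<xi> * U) +
      (1 + \<xi>) * L3 * (N / 2 + \<xi> / 6 * (N + 2 * W))"
    by (simp add: field_simps)
  also have "(1 + \<xi>) * L3 * (N / 2 + \<xi> / 6 * (N + 2 * W)) \<le>
      (1 + \<xi>) * L3 * ((1 + \<xi>) / 3 * (N + 2 * W))"
  proof (intro mult_left_mono)
    have "N / 2 + \<xi> / 6 * (N + 2 * W) + (\<xi> - 1) / 6 * N + (\<xi> + 2) / 3 * W = (1 + \<xi>) / 3 * (N + 2 * W)"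
      by (simp add: field_simps)
    moreover have "0 \<le> (\<xi> - 1) / 6 * N" "0 \<le> (\<xi> + 2) / 3 * W"
      using nonneg \<xi> by simp_all
    ultimately show "N / 2 + \<xi> / 6 * (N + 2 * W) \<le> (1 + \<xi>) / 3 * (N + 2 * W)"
      by linarith
  qed (use \<xi> L3_pos in auto)
  also have "(1 + \<xi>) * L3 * ((1 + \<xi>) / 3 * (N + 2 * W)) = (1 + k) * ((\<xi> + \<xi>\<^sup>2) * L3 / 3 * (N + 2 * W))"
  proof -
    have "(1 + k) * (\<xi> + \<xi>\<^sup>2) = (1 + \<xi>) * (\<xi> + k * \<xi>)"
      by (simp add: power2_eq_square algebra_simps)
    then have "(1 + k) * (\<xi> + \<xi>\<^sup>2) = (1 + \<xi>) * (1 + \<xi>)"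
      using k by simp
    then have "((1 + k) * (\<xi> + \<xi>\<^sup>2)) * (L3 / 3 * (N + 2 * W)) =
        ((1 + \<xi>) * (1 + \<xi>)) * (L3 / 3 * (N + 2 * W))"
      by (rule arg_cong)
    then show ?thesis
      by (simp only: times_divide_eq_left times_divide_eq_right mult_ac)
  qed
  finally show ?thesis
    by (simp add: ref_form_def quartic_form_def defs distrib_left mult_ac)
qed

text \<open>The lower Hessian bound is used with weight \<open>\<theta> < 1\<close> only, the rest being convexity; otherwise
  the negative quartic term would not be compensated for \<open>\<xi> \<le> 3\<close>.\<close>

lemma ref_form_le_reg_form:
  assumes z: "z \<in> euclid d" and x: "x \<in> euclid d" and u: "u \<in> euclid d"
  shows "\<mu> * ref_form z x u \<le> reg_form z x u"
proof -
  define N U W a k \<theta> where "N = (norm (x - z))\<^sup>2 * (norm u)\<^sup>2" "U = \<delta> * (norm u)\<^sup>2"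
    "W = (inner (x - z) u)\<^sup>2" "a = inner (hess d f z u) u" "k = 1 / \<xi>" "\<theta> = \<xi> / (2 * \<xi> + 1)"
  note defs = this
  have "1 - k = (\<xi> - 1) / \<xi>"
    using \<xi> by (simp add: defs field_simps)
  then have \<theta>: "0 < \<theta>" "\<theta> < 1" "\<theta> * (1 - k) = \<mu>"
    using \<xi> by (auto simp: defs \<mu>_def)
  have nonneg: "0 \<le> N" "0 \<le> W" "0 \<le> U"
    using \<delta> by (auto simp: defs)
  have c: "0 \<le> inner (hess d f x u) u"
    by (rule hess_nonneg[OF x u])
  have "\<theta> * ((1 - k) * a - (1 + \<xi>) * (L3 / 2 * N)) \<le> \<theta> * inner (hess d f x u) u"
    using hess_sandwich(2)[of z "x - z" u \<xi>] assms \<xi> \<theta>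
    by (intro mult_left_mono) (simp_all add: defs mult_ac)
  also have "\<dots> \<le> inner (hess d f x u) u"
    using c \<theta> by (intro mult_left_le_one_le) auto
  finally have "\<theta> * (1 - k) * a - \<theta> * (1 + \<xi>) * (L3 / 2 * N) \<le> inner (hess d f x u) u"
    by (simp add: algebra_simps)
  then have 1: "\<mu> * a - \<theta> * (1 + \<xi>) * (L3 / 2 * N) \<le> inner (hess d f x u) u"
    using \<theta> by simp
  have 2: "\<mu> * (inner (H z u) u - U) \<le> \<mu> * a"
    using H_form[OF z u] \<mu>_pos by (intro mult_left_mono) (auto simp: defs)
  \<comment> \<open>The factor \<open>1 + \<xi>\<close> collects the estimator error \<delta> and
    the term \<open>\<xi> * \<delta>\<close> of \<open>ref_form\<close>.\<close>
  have 3: "\<mu> * (1 + \<xi>) * U \<le> lam_min * (norm u)\<^sup>2"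
  proof -
    have "lam_min * (norm u)\<^sup>2 = (1 + \<xi>) * (\<xi> - 1) / \<xi> * U"
      by (simp add: lam_min_def defs field_simps power2_eq_square)
    moreover have "\<mu> * (1 + \<xi>) \<le> (1 + \<xi>) * (\<xi> - 1) / \<xi>"
    proof -
      have "\<mu> \<le> (\<xi> - 1) / \<xi>"
        unfolding \<mu>_def using \<xi> by (intro divide_left_mono) auto
      then have "\<mu> * (1 + \<xi>) \<le> (\<xi> - 1) / \<xi> * (1 + \<xi>)"
        using \<xi> by (intro mult_right_mono) auto
      then show ?thesis
        by (simp add: mult.commute)
    qed
    ultimately show ?thesis
      using nonneg(3) by (simp only: mult_right_mono)
  qed
  \<comment> \<open>The choice of \<theta> makes the coefficients of \<open>N\<close> equal,
    \<open>\<theta> / 2 + \<mu> * \<xi> / 3 = \<xi> / 6\<close>; for \<open>W\<close> the bound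
    \<open>\<mu> \<le> 1 / 2\<close> suffices.\<close>
  have 4: "\<theta> * (1 + \<xi>) * (L3 / 2 * N) + \<mu> * ((\<xi> + \<xi>\<^sup>2) * L3 / 3 * (N + 2 * W)) \<le>
      (1 + \<xi>) * \<xi> * L3 / 6 * (N + 2 * W)"
  proof -
    have "\<theta> * (1 + \<xi>) * (L3 / 2 * N) + \<mu> * ((\<xi> + \<xi>\<^sup>2) * L3 / 3 * (N + 2 * W)) =
        (1 + \<xi>) * L3 * ((\<theta> / 2 + \<mu> * \<xi> / 3) * N + \<mu> * \<xi> / 3 * (2 * W))"
      by (simp add: power2_eq_square field_simps)
    also have "\<theta> / 2 + \<mu> * \<xi> / 3 = \<xi> / 6"
    proof -
      have "2 * \<xi> + 1 \<noteq> 0"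
        using \<xi> by simp
      then show ?thesis
        unfolding defs \<mu>_def by (simp add: divide_simps) (simp add: algebra_simps)
    qed
    also have "(1 + \<xi>) * L3 * (\<xi> / 6 * N + \<mu> * \<xi> / 3 * (2 * W)) \<le>
        (1 + \<xi>) * L3 * (\<xi> / 6 * N + \<xi> / 6 * (2 * W))"
    proof (intro mult_left_mono add_left_mono mult_right_mono)
      have "\<mu> \<le> 1 / 2"
        using \<xi> by (simp add: \<mu>_def field_simps)
      then show "\<mu> * \<xi> / 3 \<le> \<xi> / 6"
        using \<xi> by simp
    qed (use \<xi> L3_pos nonneg in auto)
    also have "(1 + \<xi>) * L3 * (\<xi> / 6 * N + \<xi> / 6 * (2 * W)) = (1 + \<xi>) * \<xi> * L3 / 6 * (N + 2 * W)"
      by (simp add: field_simps)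
    finally show ?thesis .
  qed
  have "\<mu> * ref_form z x u =
      \<mu> * (inner (H z u) u - U) + \<mu> * (1 + \<xi>) * U + \<mu> * ((\<xi> + \<xi>\<^sup>2) * L3 / 3 * (N + 2 * W))"
    by (simp add: ref_form_def quartic_form_def defs algebra_simps)
  also have "\<dots> \<le> inner (hess d f x u) u + lam_min * (norm u)\<^sup>2 +
      (1 + \<xi>) * \<xi> * L3 / 6 * (N + 2 * W)"
    using 1 2 3 4 by linarith
  also have "\<dots> = reg_form z x u"
    by (simp add: reg_form_def quartic_form_def defs)
  finally show ?thesis .
qed

text \<open>Replacing the estimator by the positive semidefinite Hessian costs at most \<delta>, and
  the regularizer of \<open>ref_fun z\<close> contributes \<open>\<xi> * \<delta>\<close>. This is
  what turns small Bregman distances into small norms.\<close>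

lemma ref_form_ge:
  assumes "z \<in> euclid d" "u \<in> euclid d"
  shows "(\<xi> - 1) * \<delta> * (norm u)\<^sup>2 \<le> ref_form z x u"
proof -
  have "0 \<le> (\<xi> + \<xi>\<^sup>2) * L3 / 3 * quartic_form (x - z) u"
    using \<xi> L3_pos by (simp add: quartic_form_def)
  then show ?thesis
    using H_form[OF assms] hess_nonneg[OF assms] unfolding ref_form_def
    by (simp add: left_diff_distrib)
qed

section \<open>Bregman distances: relative smoothness and strong convexity\<close>

lemma DERIV_reg_obj:
  assumes "z \<in> euclid d" "x \<in> euclid d" "u \<in> euclid d"
  shows "((\<lambda>s. reg_obj z (x + s *\<^sub>R u)) has_real_derivative inner (reg_grad z (x + s *\<^sub>R u)) u) (at s)"
  using assms by (intro DERIV_line[OF has_derivative_reg_obj]) auto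

lemma DERIV_ref_fun:
  assumes "z \<in> euclid d" "x \<in> euclid d" "u \<in> euclid d"
  shows "((\<lambda>s. ref_fun z (x + s *\<^sub>R u)) has_real_derivative inner (ref_grad z (x + s *\<^sub>R u)) u) (at s)"
  using assms by (intro DERIV_line[OF has_derivative_ref_fun]) auto

text \<open>By the comparison of the forms, \<open>(1 + 1 / \<xi>)\<close> times
  \<open>ref_fun z\<close> minus \<open>reg_obj z\<close> is convex along the segment, hence lies
  above its tangent at \<open>y\<close>. The next two lemmas follow the same pattern.\<close>

lemma bregman_reg_le:
  assumes z: "z \<in> euclid d" and y: "y \<in> euclid d" and y': "y' \<in> euclid d"
  shows "bregman d (reg_obj z) y y' \<le> (1 + 1 / \<xi>) * bregman d (ref_fun z) y y'"
proof -
  define u where "u = y' - y"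
  have u: "u \<in> euclid d" "y + u = y'"
    using y y' by (auto simp: u_def)
  let ?p = "\<lambda>s. (1 + 1 / \<xi>) * ref_fun z (y + s *\<^sub>R u) - reg_obj z (y + s *\<^sub>R u)"
  let ?p' = "\<lambda>s. (1 + 1 / \<xi>) * inner (ref_grad z (y + s *\<^sub>R u)) u - inner (reg_grad z (y + s *\<^sub>R u)) u"
  have "?p 0 + ?p' 0 \<le> ?p 1"
  proof (rule second_order_convexity)
    fix s
    show "(?p has_real_derivative ?p' s) (at s)"
      by (intro DERIV_diff DERIV_cmult DERIV_reg_obj DERIV_ref_fun z y u)
    show "(?p' has_real_derivative (1 + 1 / \<xi>) * ref_form z (y + s *\<^sub>R u) u
        - reg_form z (y + s *\<^sub>R u) u) (at s)"
      by (intro DERIV_diff DERIV_cmult DERIV_reg_grad DERIV_ref_grad z y u)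
    show "0 \<le> (1 + 1 / \<xi>) * ref_form z (y + s *\<^sub>R u) u - reg_form z (y + s *\<^sub>R u) u"
      using reg_form_le_ref_form[OF z _ u(1), of "y + s *\<^sub>R u"] y u by auto
  qed
  then show ?thesis
    using u y z by (simp add: bregman_def grad_reg_obj grad_ref_fun u_def[symmetric] right_diff_distrib)
qed

lemma bregman_reg_ge:
  assumes z: "z \<in> euclid d" and y: "y \<in> euclid d" and y': "y' \<in> euclid d"
  shows "\<mu> * bregman d (ref_fun z) y y' \<le> bregman d (reg_obj z) y y'"
proof -
  define u where "u = y' - y"
  have u: "u \<in> euclid d" "y + u = y'"
    using y y' by (auto simp: u_def)
  let ?p = "\<lambda>s. reg_obj z (y + s *\<^sub>R u) - \<mu> * ref_fun z (y + s *\<^sub>R u)"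
  let ?p' = "\<lambda>s. inner (reg_grad z (y + s *\<^sub>R u)) u - \<mu> * inner (ref_grad z (y + s *\<^sub>R u)) u"
  have "?p 0 + ?p' 0 \<le> ?p 1"
  proof (rule second_order_convexity)
    fix s
    show "(?p has_real_derivative ?p' s) (at s)"
      by (intro DERIV_diff DERIV_cmult DERIV_reg_obj DERIV_ref_fun z y u)
    show "(?p' has_real_derivative reg_form z (y + s *\<^sub>R u) u - \<mu> * ref_form z (y + s *\<^sub>R u) u) (at s)"
      by (intro DERIV_diff DERIV_cmult DERIV_reg_grad DERIV_ref_grad z y u)
    show "0 \<le> reg_form z (y + s *\<^sub>R u) u - \<mu> * ref_form z (y + s *\<^sub>R u) u"
      using ref_form_le_reg_form[OF z _ u(1), of "y + s *\<^sub>R u"] y u by auto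
  qed
  then show ?thesis
    using u y z by (simp add: bregman_def grad_reg_obj grad_ref_fun u_def[symmetric] right_diff_distrib)
qed

lemma bregman_ref_ge:
  assumes z: "z \<in> euclid d" and y: "y \<in> euclid d" and y': "y' \<in> euclid d"
  shows "(\<xi> - 1) * \<delta> / 2 * (norm (y' - y))\<^sup>2 \<le> bregman d (ref_fun z) y y'"
proof -
  define u where "u = y' - y"
  have u: "u \<in> euclid d" "y + u = y'"
    using y y' by (auto simp: u_def)
  define c where "c = (\<xi> - 1) * \<delta> * (norm u)\<^sup>2"
  let ?p = "\<lambda>s. ref_fun z (y + s *\<^sub>R u) - c / 2 * s\<^sup>2"
  let ?p' = "\<lambda>s. inner (ref_grad z (y + s *\<^sub>R u)) u - c * s"
  have "?p 0 + ?p' 0 \<le> ?p 1"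
  proof (rule second_order_convexity)
    fix s
    show "(?p has_real_derivative ?p' s) (at s)"
      by (intro DERIV_diff DERIV_ref_fun z y u) (auto intro!: derivative_eq_intros)
    show "(?p' has_real_derivative ref_form z (y + s *\<^sub>R u) u - c) (at s)"
      by (intro DERIV_diff DERIV_ref_grad z) (auto intro!: derivative_eq_intros)
    show "0 \<le> ref_form z (y + s *\<^sub>R u) u - c"
      using ref_form_ge[OF z u(1)] by (simp add: c_def)
  qed
  then show ?thesis
    using u y z by (simp add: bregman_def grad_ref_fun u_def[symmetric] c_def)
qed

lemma bregman_ref_nonneg:
  assumes "z \<in> euclid d" "y \<in> euclid d" "y' \<in> euclid d"
  shows "0 \<le> bregman d (ref_fun z) y y'"
proof -
  have "0 \<le> (\<xi> - 1) * \<delta> / 2 * (norm (y' - y))\<^sup>2"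
    using \<xi> \<delta> by simp
  then show ?thesis
    using bregman_ref_ge[OF assms] by linarith
qed

section \<open>Existence of steps and of an interior minimizer\<close>

definition trust_region :: "fseq \<Rightarrow> fseq set" where
  "trust_region z = {u \<in> euclid d. norm (u - z) \<le> radius z}"

lemma radius_nonneg: "0 \<le> radius z"
  using L3_pos \<xi>_square by (simp add: radius_def)

lemma trust_region_properties:
  assumes "z \<in> euclid d"
  shows "convex (trust_region z)" "trust_region z \<subseteq> euclid d" "compact (trust_region z)"
    "z \<in> trust_region z"
proof -
  have "trust_region z = euclid d \<inter> cball z (radius z)"
    by (auto simp: trust_region_def dist_norm norm_minus_commute)
  then show "convex (trust_region z)"
    by (simp add: convex_Int subspace_imp_convex[OF subspace_euclid])
  show "compact (trust_region z)"
    unfolding trust_region_def by (rule compact_euclid_cball)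
qed (use assms radius_nonneg in \<open>auto simp: trust_region_def\<close>)

lemma step_exists:
  assumes z: "z \<in> euclid d"
  shows "\<exists>y'. step z y y'"
proof -
  let ?F = "\<lambda>u. inner (grad d (reg_obj z) y) (u - y) + 2 * (1 + 1 / \<xi>) * bregman d (ref_fun z) y u"
  have "continuous_on (trust_region z) (ref_fun z)"
    using has_derivative_ref_fun[OF z] trust_region_properties(2)[OF z]
    by (meson continuous_on_subset differentiable_def differentiable_imp_continuous_on
        differentiable_on_def)
  then have "continuous_on (trust_region z) ?F"
    unfolding bregman_def by (intro continuous_intros)
  from continuous_attains_inf[OF trust_region_properties(3)[OF z] _ this]
  obtain y' where "y' \<in> trust_region z" "\<And>u. u \<in> trust_region z \<Longrightarrow> ?F y' \<le> ?F u"
    using trust_region_properties(4)[OF z] by blast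
  then show ?thesis
    unfolding step_def is_arg_min_linorder trust_region_def by blast
qed

lemma step_in_trust_region: "step z y y' \<Longrightarrow> y' \<in> trust_region z"
  by (simp add: step_def is_arg_min_linorder trust_region_def)

text \<open>A minimizer \<open>y\<close> over the ball exists by compactness. Optimality tested at
  \<open>z\<close>, together with monotonicity of the gradient of \<open>f\<close>, gives
  \<open>lam z y * norm (y - z) \<le> norm (grad d f z)\<close>. The quartic part of
  \<open>lam\<close> then places \<open>y\<close> strictly inside the ball, so its gradient
  vanishes, while the constant part yields the last claim.\<close>

lemma reg_minimizer:
  assumes z: "z \<in> euclid d" and nz: "grad d f z \<noteq> 0"
  obtains y where "y \<in> trust_region z" "reg_grad z y = 0" "y \<noteq> z"
    "lam_min * norm (y - z) \<le> norm (grad d f z)"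
proof -
  have "continuous_on (trust_region z) (reg_obj z)"
    using has_derivative_reg_obj[OF z] trust_region_properties(2)[OF z]
    by (meson continuous_on_subset differentiable_def differentiable_imp_continuous_on
        differentiable_on_def)
  from continuous_attains_inf[OF trust_region_properties(3)[OF z] _ this]
  obtain y where y: "y \<in> trust_region z"
    and min: "\<And>u. u \<in> trust_region z \<Longrightarrow> reg_obj z y \<le> reg_obj z u"
    using trust_region_properties(4)[OF z] by blast
  have ye: "y \<in> euclid d"
    using y trust_region_properties(2)[OF z] by blast
  define g r where "g = reg_grad z y" "r = norm (y - z)"
  note gr = this
  have VI: "0 \<le> inner g (u - y)" if "u \<in> trust_region z" for u
    unfolding gr using trust_region_properties[OF z] y that
    by (intro minimizer_variational_inequality[OF min _ _ _ _ has_derivative_reg_obj[OF z ye]])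
  have lam_r: "lam z y * r \<le> norm (grad d f z)"
  proof (cases "y = z")
    case False
    have "inner (grad d f y + lam z y *\<^sub>R (y - z)) (y - z) \<le> 0"
      using VI[of z] trust_region_properties[OF z] by (simp add: gr reg_grad_def inner_diff_right)
    then have "lam z y * r\<^sup>2 \<le> - inner (grad d f y) (y - z)"
      by (simp add: inner_add_left gr power2_norm_eq_inner)
    also have "\<dots> \<le> - inner (grad d f z) (y - z)"
      using grad_monotone[OF z ye] by (simp add: inner_diff_left)
    also have "\<dots> \<le> norm (grad d f z) * r"
      unfolding gr using Cauchy_Schwarz_ineq2[of "grad d f z" "y - z"] by linarith
    finally have "(lam z y * r) * r \<le> norm (grad d f z) * r"
      by (simp add: power2_eq_square)
    then show ?thesis
      using False by (simp add: gr)
  qed (simp add: gr)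
  \<comment> \<open>Here \<open>radius z\<close> is twice the cube root of \<open>c\<close>, and the
    quartic part of \<open>lam z y\<close> gives \<open>r ^ 3 \<le> c\<close>. The minimizer thus
    lies within half the radius, and \<open>c\<close> is positive because the gradient at
    \<open>z\<close> is nonzero.\<close>
  have "r < radius z"
  proof -
    define c where "c = 12 * norm (grad d f z) / (L3 * (\<xi>\<^sup>2 - 1))"
    have c: "0 < c"
      using nz L3_pos \<xi>_square by (simp add: c_def)
    have "(1 + \<xi>) * \<xi> * L3 / 6 * r ^ 3 \<le> lam z y * r"
    proof -
      have "lam z y * r = lam_min * r + (1 + \<xi>) * \<xi> * L3 / 6 * r ^ 3"
        unfolding lam_def lam_min_def gr power2_eq_square power3_eq_cube
        by (simp only: distrib_right mult.assoc)
      moreover have "0 \<le> lam_min * r"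
        using lam_min_pos by (simp add: gr)
      ultimately show ?thesis
        by linarith
    qed
    then have "(1 + \<xi>) * \<xi> * L3 * r ^ 3 \<le> 6 * norm (grad d f z)"
      using lam_r by simp
    also have "\<dots> = L3 * (\<xi>\<^sup>2 - 1) * c / 2"
      using L3_pos \<xi>_square by (simp add: c_def)
    also have "\<dots> \<le> L3 * ((1 + \<xi>) * \<xi>) * c"
    proof -
      have "(\<xi>\<^sup>2 - 1) / 2 \<le> (1 + \<xi>) * \<xi>"
        using \<xi> by (simp add: power2_eq_square algebra_simps)
      then have "L3 * ((\<xi>\<^sup>2 - 1) / 2) * c \<le> L3 * ((1 + \<xi>) * \<xi>) * c"
        using L3_pos c by (intro mult_right_mono mult_left_mono) auto
      then show ?thesis
        by simp
    qed
    finally have "((1 + \<xi>) * \<xi> * L3) * r ^ 3 \<le> ((1 + \<xi>) * \<xi> * L3) * c"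
      by (simp add: mult_ac)
    then have "r ^ 3 \<le> c"
      using \<xi> L3_pos by (subst (asm) mult_le_cancel_left_pos) auto
    then have "root 3 (r ^ 3) \<le> root 3 c"
      by simp
    then have "r \<le> root 3 c"
      by (simp add: real_root_power_cancel gr)
    also have "\<dots> < 2 * root 3 c"
      using c by simp
    finally show ?thesis
      by (simp add: radius_def c_def)
  qed
  have "g = 0"
  proof (rule ccontr)
    assume g: "g \<noteq> 0"
    \<comment> \<open>The step along \<open>- g\<close> whose length is the slack
      \<open>radius z - r\<close>, so that it cannot leave the ball.\<close>
    define \<tau> where "\<tau> = (radius z - r) / norm g"
    have \<tau>: "0 < \<tau>" "\<tau> * norm g = radius z - r"
      using g \<open>r < radius z\<close> by (auto simp: \<tau>_def)
    have "norm (y - \<tau> *\<^sub>R g - z) \<le> norm (y - z) + norm (\<tau> *\<^sub>R g)"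
      using norm_triangle_ineq4[of "y - z" "\<tau> *\<^sub>R g"] by (simp add: algebra_simps)
    also have "\<dots> = radius z"
      using \<tau> by (simp add: gr)
    finally have "y - \<tau> *\<^sub>R g \<in> trust_region z"
      using ye reg_grad_in_euclid[OF z ye] by (auto simp: trust_region_def gr)
    from VI[OF this] have "\<tau> * inner g g \<le> 0"
      by (simp add: inner_diff_right)
    then show False
      using \<tau>(1) g inner_gt_zero_iff[of g] mult_pos_pos[of \<tau> "inner g g"] by linarith
  qed
  moreover have "y \<noteq> z"
    using \<open>g = 0\<close> nz by (auto simp: gr reg_grad_def)
  moreover have "lam_min * norm (y - z) \<le> norm (grad d f z)"
    using lam_r mult_right_mono[OF lam_min_le[of z y], of r] by (simp add: gr)
  ultimately show ?thesis
    using that[of y] y by (simp add: gr)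
qed

section \<open>Linear convergence of the steps\<close>

lemma three_point:
  assumes "z \<in> euclid d" "y \<in> euclid d" "y' \<in> euclid d"
  shows "inner (ref_grad z y' - ref_grad z y) (u - y') =
    bregman d (ref_fun z) y u - bregman d (ref_fun z) y' u - bregman d (ref_fun z) y y'"
  using assms by (simp add: bregman_def grad_ref_fun algebra_simps)

text \<open>The optimality condition of \<open>y'\<close> is tested at \<open>u\<close> and
  rewritten by the three point identity. Relative smoothness bounds \<open>reg_obj z\<close> at
  \<open>y'\<close>, relative strong convexity bounds it at \<open>u\<close>, and what remains is
  \<open>2 * L\<close> times the new distance against \<open>2 * L - \<mu>\<close> times the old
  one.\<close>

lemma step_contraction:
  assumes z: "z \<in> euclid d" and y: "y \<in> euclid d" and step: "step z y y'"
    and u: "u \<in> trust_region z" "reg_grad z u = 0"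
  shows "bregman d (ref_fun z) y' u \<le> rate * bregman d (ref_fun z) y u"
proof -
  define L where "L = 1 + 1 / \<xi>"
  have L: "0 < L"
    using \<xi> by (simp add: L_def add_pos_pos)
  let ?F = "\<lambda>v. inner (grad d (reg_obj z) y) (v - y) + 2 * (1 + 1 / \<xi>) * bregman d (ref_fun z) y v"
  have y': "y' \<in> trust_region z"
    by (rule step_in_trust_region[OF step])
  have y'e: "y' \<in> euclid d" and ue: "u \<in> euclid d"
    using y' u trust_region_properties[OF z] by auto
  have "0 \<le> inner (reg_grad z y + (2 * L) *\<^sub>R (ref_grad z y' - ref_grad z y)) (u - y')"
  proof (rule minimizer_variational_inequality[of "trust_region z" ?F])
    show "?F y' \<le> ?F v" if "v \<in> trust_region z" for v
      using step that unfolding step_def is_arg_min_linorder trust_region_def by blast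
    show "(?F has_derivative (\<lambda>h. inner (reg_grad z y + (2 * L) *\<^sub>R (ref_grad z y' - ref_grad z y)) h))
        (at y' within euclid d)"
      unfolding bregman_def
      by (auto intro!: derivative_eq_intros has_derivative_ref_fun z y'e
          simp: grad_reg_obj grad_ref_fun z y inner_add_left inner_diff_left L_def \<xi>_nonzero algebra_simps)
  qed (use trust_region_properties[OF z] y' u in auto)
  then have VI: "0 \<le> inner (reg_grad z y) (u - y') + 2 * L *
      (bregman d (ref_fun z) y u - bregman d (ref_fun z) y' u - bregman d (ref_fun z) y y')"
    using three_point[OF z y y'e] by (simp add: inner_add_left)
  have "inner (reg_grad z y) (u - y') =
      (reg_obj z u - bregman d (reg_obj z) y u) - (reg_obj z y' - bregman d (reg_obj z) y y')"
    using z y by (simp add: bregman_def grad_reg_obj inner_diff_right)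
  \<comment> \<open>This amounts to \<open>reg_obj z u \<le> reg_obj z y'\<close>, which holds
    because \<open>u\<close> is stationary and \<open>reg_obj z\<close> has nonnegative Bregman
    distances.\<close>
  also have "\<dots> \<le> bregman d (reg_obj z) y y' - bregman d (reg_obj z) y u"
  proof -
    have "0 \<le> \<mu> * bregman d (ref_fun z) u y'"
      using bregman_ref_nonneg[OF z ue y'e] \<mu>_pos by simp
    also have "\<dots> \<le> bregman d (reg_obj z) u y'"
      by (rule bregman_reg_ge[OF z ue y'e])
    finally show ?thesis
      using u z ue by (simp add: bregman_def[of d "reg_obj z" u] grad_reg_obj)
  qed
  also have "\<dots> \<le> 2 * L * bregman d (ref_fun z) y y' - \<mu> * bregman d (ref_fun z) y u"
  proof -
    have "0 \<le> L * bregman d (ref_fun z) y y'"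
      using bregman_ref_nonneg[OF z y y'e] L by simp
    then show ?thesis
      using bregman_reg_le[OF z y y'e] bregman_reg_ge[OF z y ue] unfolding L_def[symmetric]
      by linarith
  qed
  finally have "2 * L * bregman d (ref_fun z) y' u \<le> (2 * L - \<mu>) * bregman d (ref_fun z) y u"
    using VI by (simp add: algebra_simps)
  also have "2 * L - \<mu> = 2 * L * rate"
    using L by (simp add: rate_def L_def[symmetric] right_diff_distrib)
  finally show ?thesis
    using L by (simp add: mult.assoc)
qed

lemma rate_bounds: "0 < rate" "rate < 1"
proof -
  have "\<mu> < 1"
    using \<xi> by (simp add: \<mu>_def)
  moreover have "1 < 2 * (1 + 1 / \<xi>)"
    using \<xi> by (simp add: field_simps)
  ultimately show "0 < rate" "rate < 1"
    using \<mu>_pos by (auto simp: rate_def)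
qed

lemma trace_in_trust_region:
  assumes z: "z \<in> euclid d" and "trace z y n" "k \<le> n"
  shows "y k \<in> trust_region z"
proof (cases k)
  case 0
  then show ?thesis
    using assms trust_region_properties(4)[OF z] by (simp add: trace_def)
next
  case (Suc j)
  then have "step z (y j) (y k)"
    using assms by (simp add: trace_def)
  then show ?thesis
    by (rule step_in_trust_region)
qed

lemma trace_contraction:
  assumes z: "z \<in> euclid d" and trace: "trace z y n" and u: "u \<in> trust_region z" "reg_grad z u = 0"
  shows "k \<le> n \<Longrightarrow> bregman d (ref_fun z) (y k) u \<le> rate ^ k * bregman d (ref_fun z) z u"
proof (induction k)
  case 0
  then show ?case
    using trace by (simp add: trace_def)
next
  case (Suc k)
  have "y k \<in> euclid d"
    using trace_in_trust_region[OF z trace, of k] Suc.prems trust_region_properties[OF z] by auto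
  moreover have "step z (y k) (y (Suc k))"
    using trace Suc.prems by (simp add: trace_def)
  ultimately have "bregman d (ref_fun z) (y (Suc k)) u \<le> rate * bregman d (ref_fun z) (y k) u"
    by (rule step_contraction[OF z _ _ u])
  also have "\<dots> \<le> rate * (rate ^ k * bregman d (ref_fun z) z u)"
    using Suc rate_bounds by (intro mult_left_mono) auto
  finally show ?case
    by simp
qed

section \<open>Distance of an iterate violating MS from the minimizer\<close>

lemma reg_grad_Lipschitz:
  assumes z: "z \<in> euclid d" and x: "x \<in> euclid d" "norm (x - z) \<le> D"
    and y: "y \<in> euclid d" "norm (y - z) \<le> D"
    and M: "\<And>p u w. p \<in> euclid d \<Longrightarrow> norm (p - z) \<le> D \<Longrightarrow> u \<in> euclid d \<Longrightarrow> w \<in> euclid d \<Longrightarrow>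
      \<bar>inner (hess d f p u) w\<bar> \<le> M * norm u * norm w"
  shows "norm (reg_grad z y - reg_grad z x) \<le>
    (M + lam_min + (1 + \<xi>) * \<xi> * L3 / 2 * D\<^sup>2) * norm (y - x)"
proof -
  define c where "c = (1 + \<xi>) * \<xi> * L3 / 6"
  have c: "0 \<le> c"
    using \<xi> L3_pos by (simp add: c_def)
  let ?q = "(norm (y - z))\<^sup>2 *\<^sub>R (y - z) - (norm (x - z))\<^sup>2 *\<^sub>R (x - z)"
  have eq: "reg_grad z y - reg_grad z x = (grad d f y - grad d f x) + lam_min *\<^sub>R (y - x) + c *\<^sub>R ?q"
    by (simp add: reg_grad_def lam_def lam_min_def c_def algebra_simps)
  have 1: "norm (grad d f y - grad d f x) \<le> M * norm (y - x)"
  proof (rule grad_Lipschitz[OF x(1) y(1)])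
    fix p u w assume p: "p \<in> closed_segment x y" and uw: "u \<in> euclid d" "w \<in> euclid d"
    have "closed_segment x y \<subseteq> euclid d \<inter> cball z D"
      using x y by (intro closed_segment_subset convex_Int convex_cball
          subspace_imp_convex[OF subspace_euclid]) (auto simp: dist_norm norm_minus_commute)
    then show "\<bar>inner (hess d f p u) w\<bar> \<le> M * norm u * norm w"
      using p uw by (intro M) (auto simp: dist_norm norm_minus_commute)
  qed
  have 2: "norm (c *\<^sub>R ?q) \<le> c * (3 * D\<^sup>2 * norm (y - x))"
    using norm_cube_Lipschitz[OF y(2) x(2)] c by (simp add: mult_left_mono)
  have "norm (reg_grad z y - reg_grad z x) \<le>
      norm (grad d f y - grad d f x) + norm (lam_min *\<^sub>R (y - x)) + norm (c *\<^sub>R ?q)"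
    unfolding eq by (intro order_trans[OF norm_triangle_ineq] add_right_mono norm_triangle_ineq)
  also have "\<dots> \<le> M * norm (y - x) + lam_min * norm (y - x) + c * (3 * D\<^sup>2 * norm (y - x))"
    using 1 2 lam_min_pos by simp
  finally show ?thesis
    by (simp add: c_def field_simps)
qed

text \<open>Near the minimizer \<open>u\<close> of \<open>reg_obj z\<close> the gradient of \<open>reg_obj z\<close> is small, while the
  distance to \<open>z\<close> is comparable to \<open>\<parallel>u - z\<parallel>\<close>; hence the MS condition holds there. Every bound is
  relative to \<open>\<parallel>u - z\<parallel>\<close>, which cancels in the end.\<close>

lemma not_MS_imp_rate_power:
  assumes z: "z \<in> euclid d" and trace: "trace z y n" and k: "k \<le> n" and not_MS: "\<not> MS z (y k)"
    and nz: "grad d f z \<noteq> 0"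
    and B: "0 \<le> B" "\<And>u. u \<in> euclid d \<Longrightarrow> inner (hess d f z u) u \<le> B * (norm u)\<^sup>2"
    and r0: "norm (grad d f z) \<le> lam_min * r0"
    and S: "S = B + (1 + \<xi>) * \<delta> + (\<xi> + \<xi>\<^sup>2) * L3 / 6 * r0\<^sup>2"
    and D: "D = r0 * (2 + S / ((\<xi> - 1) * \<delta>))"
    and M: "0 \<le> M"
      "\<And>p u w. p \<in> euclid d \<Longrightarrow> norm (p - z) \<le> D \<Longrightarrow> u \<in> euclid d \<Longrightarrow> w \<in> euclid d \<Longrightarrow>
        \<bar>inner (hess d f p u) w\<bar> \<le> M * norm u * norm w"
    and M': "M' = M + lam_min + (1 + \<xi>) * \<xi> * L3 / 2 * D\<^sup>2"
  shows "lam_min\<^sup>2 * ((\<xi> - 1) * \<delta>) < 16 * S * M'\<^sup>2 * rate ^ k"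
proof -
  obtain u where u: "u \<in> trust_region z" "reg_grad z u = 0" "u \<noteq> z"
    and u_le: "lam_min * norm (u - z) \<le> norm (grad d f z)"
    using reg_minimizer[OF z nz] by blast
  have ue: "u \<in> euclid d" and ye: "y k \<in> euclid d"
    using u trace_in_trust_region[OF z trace k] trust_region_properties[OF z] by auto
  define r \<tau> s where "r = norm (u - z)" "\<tau> = norm (y k - u)" "s = (\<xi> - 1) * \<delta>"
  note defs = this
  have r: "0 < r"
    using u by (simp add: defs)
  have s: "0 < s"
    using \<xi> \<delta> by (simp add: defs)
  have "lam_min * r \<le> lam_min * r0"
    using u_le r0 by (simp add: defs)
  then have r_le: "r \<le> r0"
    using lam_min_pos by simp
  have S_pos: "0 < S"
    unfolding S using B \<xi> \<delta> L3_pos by (simp add: add_pos_nonneg add_nonneg_pos)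
  have rate_le: "rate ^ k \<le> 1"
    using rate_bounds by (simp add: power_le_one)
  \<comment> \<open>Value and gradient of \<open>ref_fun z\<close> vanish at \<open>z\<close>, so
    the Bregman distance is just \<open>ref_fun z u\<close>. In the quartic term one factor
    \<open>r\<^sup>2\<close> is traded for \<open>r0\<^sup>2\<close>, which keeps the bound
    proportional to \<open>r\<^sup>2\<close>.\<close>
  have init: "bregman d (ref_fun z) z u \<le> S / 2 * r\<^sup>2"
  proof -
    have uz: "u - z \<in> euclid d"
      using ue z by auto
    have "bregman d (ref_fun z) z u = 1/2 * (inner (H z (u - z)) (u - z) + \<xi> * \<delta> * r\<^sup>2) +
        (\<xi> + \<xi>\<^sup>2) * L3 / 12 * r ^ 4"
      using linear_0[OF linear_H[OF z]] unfolding bregman_def grad_ref_fun[OF z z]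
      by (simp add: ref_grad_def ref_fun_def defs inner_add_left power2_norm_eq_inner)
    also have "\<dots> \<le> 1/2 * ((B * r\<^sup>2 + \<delta> * r\<^sup>2) + \<xi> * \<delta> * r\<^sup>2) + (\<xi> + \<xi>\<^sup>2) * L3 / 12 * (r0\<^sup>2 * r\<^sup>2)"
    proof (intro add_mono mult_left_mono order.refl)
      show "inner (H z (u - z)) (u - z) \<le> B * r\<^sup>2 + \<delta> * r\<^sup>2"
        using H_form[OF z uz] B(2)[OF uz] by (simp add: defs)
      have "r\<^sup>2 * r\<^sup>2 \<le> r0\<^sup>2 * r\<^sup>2"
        using r r_le by (intro mult_right_mono power_mono) auto
      then show "r ^ 4 \<le> r0\<^sup>2 * r\<^sup>2"
        by (simp flip: power_add)
    qed (use \<xi> L3_pos \<delta> in auto)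
    also have "\<dots> = S / 2 * r\<^sup>2"
      unfolding S by (simp add: field_simps)
    finally show ?thesis .
  qed
  have \<tau>: "s * \<tau>\<^sup>2 \<le> rate ^ k * (S * r\<^sup>2)"
  proof -
    have "s / 2 * \<tau>\<^sup>2 \<le> bregman d (ref_fun z) (y k) u"
      using bregman_ref_ge[OF z ye ue] by (simp add: defs norm_minus_commute)
    also have "\<dots> \<le> rate ^ k * bregman d (ref_fun z) z u"
      by (rule trace_contraction[OF z trace u(1,2) k])
    also have "\<dots> \<le> rate ^ k * (S / 2 * r\<^sup>2)"
      using init rate_bounds by (intro mult_left_mono) auto
    finally show ?thesis
      by simp
  qed
  \<comment> \<open>The crude estimate \<open>t \<le> (1 + t)\<^sup>2\<close> avoids a square root;
    only polynomial size matters. It confines \<open>y k\<close> to the ball of radius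
    \<open>D\<close> on which the Hessian bound \<open>M\<close> is available.\<close>
  have "\<tau>\<^sup>2 \<le> (r * (1 + S / s))\<^sup>2"
  proof -
    have "s * \<tau>\<^sup>2 \<le> 1 * (S * r\<^sup>2)"
      using \<tau> rate_le S_pos by (meson mult_right_mono order_trans less_imp_le mult_nonneg_nonneg zero_le_power2)
    then have "\<tau>\<^sup>2 \<le> r\<^sup>2 * (S / s)"
      using s by (simp add: field_simps)
    also have "\<dots> \<le> r\<^sup>2 * (1 + S / s)\<^sup>2"
    proof (intro mult_left_mono)
      have "0 \<le> S / s" "0 \<le> (S / s)\<^sup>2"
        using S_pos s by auto
      moreover have "(1 + S / s)\<^sup>2 = 1 + 2 * (S / s) + (S / s)\<^sup>2"
        by (simp add: power2_sum)
      ultimately show "S / s \<le> (1 + S / s)\<^sup>2"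
        by linarith
    qed simp
    finally show ?thesis
      by (simp add: power_mult_distrib)
  qed
  then have "\<tau> \<le> r * (1 + S / s)"
    using r S_pos s by (intro power2_le_imp_le[of \<tau>]) auto
  moreover have "norm (y k - z) \<le> \<tau> + r"
    using norm_triangle_ineq[of "y k - u" "u - z"] by (simp add: defs)
  ultimately have "norm (y k - z) \<le> r * (2 + S / s)"
    by (simp add: algebra_simps)
  also have "\<dots> \<le> D"
    unfolding D defs(3)[symmetric] using r_le S_pos s by (intro mult_right_mono) auto
  finally have y_le: "norm (y k - z) \<le> D" .
  have u_le: "norm (u - z) \<le> D"
  proof -
    have "r * 1 \<le> r0 * (2 + S / s)"
      using r r_le S_pos s by (intro mult_mono) auto
    then show ?thesis
      by (simp add: D defs)
  qed
  have "norm (reg_grad z (y k) - reg_grad z u) \<le> M' * norm (y k - u)"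
    unfolding M' by (rule reg_grad_Lipschitz[OF z ue u_le ye y_le M(2)])
  then have grad_le: "norm (reg_grad z (y k)) \<le> M' * \<tau>"
    using u by (simp add: defs)
  have M'_ge: "lam_min \<le> M'"
    unfolding M' using M \<xi> L3_pos by simp
  \<comment> \<open>Otherwise \<open>\<tau> \<le> r / 4\<close>, so \<open>y k\<close> has distance
    at least \<open>r / 2\<close> from \<open>z\<close> and the threshold in \<open>MS\<close> is at
    least \<open>lam_min * r / 4\<close>, which the gradient does not exceed.\<close>
  have "lam_min * r / 4 < M' * \<tau>"
  proof (rule ccontr)
    assume "\<not> lam_min * r / 4 < M' * \<tau>"
    then have small: "M' * \<tau> \<le> lam_min * r / 4"
      by simp
    have "lam_min * \<tau> \<le> M' * \<tau>"
      using M'_ge by (intro mult_right_mono) (auto simp: defs)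
    then have "lam_min * \<tau> \<le> lam_min * (r / 4)"
      using small by simp
    then have "\<tau> \<le> r / 4"
      using lam_min_pos by simp
    moreover have "r \<le> \<tau> + norm (y k - z)"
      using norm_triangle_ineq[of "u - y k" "y k - z"] by (simp add: defs norm_minus_commute)
    ultimately have "r / 2 \<le> norm (y k - z)"
      using r by simp
    then have "lam_min / 2 * (r / 2) \<le> lam z (y k) / 2 * norm (y k - z)"
      using lam_min_le[of z "y k"] lam_min_pos r by (intro mult_mono) auto
    then have "MS z (y k)"
      using small grad_le by (simp add: MS_def reg_grad_def mult.commute[of r])
    then show False
      using not_MS by simp
  qed
  then have "(lam_min * r / 4)\<^sup>2 < (M' * \<tau>)\<^sup>2"
    using lam_min_pos r by (intro power_strict_mono) auto
  then have "(lam_min * r / 4)\<^sup>2 * s < (M' * \<tau>)\<^sup>2 * s"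
    using s by (intro mult_strict_right_mono)
  also have "\<dots> = M'\<^sup>2 * (s * \<tau>\<^sup>2)"
    by (simp add: power_mult_distrib)
  also have "\<dots> \<le> M'\<^sup>2 * (rate ^ k * (S * r\<^sup>2))"
    using \<tau> by (intro mult_left_mono) auto
  finally have "(lam_min\<^sup>2 * s) * r\<^sup>2 < (16 * S * M'\<^sup>2 * rate ^ k) * r\<^sup>2"
    by (simp add: power_mult_distrib power_divide mult_ac)
  then show ?thesis
    using r by (simp add: defs)
qed

end

section \<open>Query points of the accelerated method\<close>

text \<open>After weakening \<open>l / 2\<close> to \<open>l\<close> and squaring, the terms
  \<open>(l * norm w)\<^sup>2\<close> cancel. The inequality pays for the squared gradient norm that
  appears when \<open>v\<close> is updated.\<close>

lemma MS_inner_le: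
  fixes g w :: "'a :: real_inner"
  assumes l: "0 < l" and MS: "norm (g + l *\<^sub>R w) \<le> l / 2 * norm w"
  shows "inner g w + (norm g)\<^sup>2 / (2 * l) \<le> 0"
proof -
  have "(norm (g + l *\<^sub>R w))\<^sup>2 \<le> (l / 2 * norm w)\<^sup>2"
    by (rule power_mono[OF MS]) simp
  also have "\<dots> \<le> (l * norm w)\<^sup>2"
    using l by (intro power_mono mult_right_mono) auto
  also have "(norm (g + l *\<^sub>R w))\<^sup>2 = (norm g)\<^sup>2 + 2 * l * inner g w + (l * norm w)\<^sup>2"
    unfolding power_mult_distrib power2_norm_eq_inner
    by (simp add: inner_add_left inner_add_right inner_commute[of w g] power2_eq_square algebra_simps)
  finally have "(norm g)\<^sup>2 + 2 * l * inner g w \<le> 0"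
    by simp
  then have "((norm g)\<^sup>2 + 2 * l * inner g w) / (2 * l) \<le> 0"
    using l by (simp add: divide_nonpos_pos)
  then show ?thesis
    using l by (simp add: add_divide_distrib)
qed

text \<open>\<open>a\<close> is the positive root of the quadratic equation in the second
  claim.\<close>

lemma step_size_equation:
  fixes l A :: real
  assumes "0 < l" "0 \<le> A" and a: "a = (1 + sqrt (1 + 4 * l * A)) / (2 * l)"
  shows "0 < a" "l * a\<^sup>2 = A + a"
proof -
  have "0 < 1 + sqrt (1 + 4 * l * A)"
    using assms by (intro add_pos_nonneg) auto
  then show "0 < a"
    using assms by simp
  have "2 * l * a - 1 = sqrt (1 + 4 * l * A)"
    using assms by simp
  then have "(2 * l * a - 1)\<^sup>2 = 1 + 4 * l * A"
    using assms by simp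
  then have "(4 * l) * (l * a\<^sup>2) = (4 * l) * (A + a)"
    by (simp add: power2_eq_square algebra_simps)
  then show "l * a\<^sup>2 = A + a"
    using assms by simp
qed

lemma (in smooth_convex) potential_step:
  assumes mem: "x \<in> euclid d" "v \<in> euclid d" "y \<in> euclid d" "z \<in> euclid d" "p \<in> euclid d"
    and A: "0 \<le> A" and l': "0 < l'" and l: "0 < l"
    and a': "a' = (1 + sqrt (1 + 4 * l' * A)) / (2 * l')" and A': "A' = A + a'"
    and z: "z = (A *\<^sub>R x + a' *\<^sub>R v) /\<^sub>R A'"
    and MS: "norm (grad d f y + l *\<^sub>R (y - z)) \<le> l / 2 * norm (y - z)"
    and \<beta>: "\<beta> = min 1 (l' / l)" and a: "a = \<beta> * a'" and A1: "A1 = A + a"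
    and xhat: "xhat = (((1 - \<beta>) * A) *\<^sub>R x + (\<beta> * A') *\<^sub>R y) /\<^sub>R A1"
  shows "A1 * (f xhat - f p) + (norm (v - a *\<^sub>R grad d f y - p))\<^sup>2 / 2 \<le>
    A * (f x - f p) + (norm (v - p))\<^sup>2 / 2"
proof -
  define g where "g = grad d f y"
  have a'_pos: "0 < a'" and a'_sq: "l' * a'\<^sup>2 = A'"
    using step_size_equation[OF l' A a'] A' by auto
  have A'_pos: "0 < A'"
    using A A' a'_pos by simp
  have \<beta>_bounds: "0 < \<beta>" "\<beta> \<le> 1" "\<beta> / l' \<le> 1 / l"
    using l l' by (auto simp: \<beta> min_def field_simps)
  have A1_pos: "0 < A1"
    using A A1 a \<beta>_bounds a'_pos by (simp add: add_nonneg_pos)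
  have A1_eq: "A1 = (1 - \<beta>) * A + \<beta> * A'"
    by (simp add: A1 a A' algebra_simps)
  have tp: "f y + inner g (p - y) \<le> f p" and tx: "f y + inner g (x - y) \<le> f x"
    unfolding g_def using mem by (auto intro: tangent_le)
  have xhat_le: "A1 * f xhat \<le> (1 - \<beta>) * A * f x + \<beta> * A' * f y"
  proof -
    define t where "t = \<beta> * A' / A1"
    have "0 \<le> (1 - \<beta>) * A"
      using \<beta>_bounds A by simp
    then have "\<beta> * A' \<le> A1"
      using A1_eq by linarith
    then have t: "0 \<le> t" "t \<le> 1" "1 - t = (1 - \<beta>) * A / A1"
      using \<beta>_bounds A'_pos A1_pos A1_eq by (auto simp: t_def field_simps)
    have "xhat = (1 - t) *\<^sub>R x + t *\<^sub>R y"
      unfolding t(3) xhat by (simp add: t_def scaleR_add_right divide_inverse mult.commute)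
    then have "f xhat \<le> (1 - t) * f x + t * f y"
      using convex_onD[OF convex t(1,2) mem(1,3)] by simp
    then have "A1 * f xhat \<le> A1 * ((1 - t) * f x + t * f y)"
      using A1_pos by simp
    also have "\<dots> = (A1 * (1 - t)) * f x + (A1 * t) * f y"
      by (simp add: distrib_left mult.assoc)
    also have "A1 * (1 - t) = (1 - \<beta>) * A"
      using A1_pos unfolding t(3) by simp
    also have "A1 * t = \<beta> * A'"
      using A1_pos by (simp add: t_def)
    finally show ?thesis .
  qed
  have "A' *\<^sub>R z = A *\<^sub>R x + a' *\<^sub>R v"
    using A'_pos by (simp add: z)
  then have "A' * inner g z = A * inner g x + a' * inner g v"
    by (metis inner_add_right inner_scaleR_right)
  \<comment> \<open>The vector \<open>v\<close> is eliminated through the definition of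
    \<open>z\<close>; the multiples of \<open>y\<close> cancel since
    \<open>A' = A + a'\<close>.\<close>
  then have "a * inner g (p - v) =
      \<beta> * (a' * inner g (p - y) + A * inner g (x - y) + A' * inner g (y - z))"
    unfolding inner_diff_right a A' by algebra
  also have "\<dots> \<le> \<beta> * (a' * (f p - f y) + A * (f x - f y) + A' * inner g (y - z))"
    using tp tx a'_pos A \<beta>_bounds by (intro mult_left_mono add_mono order.refl) auto
  finally have inner_le: "a * inner g (p - v) \<le> \<dots>" .
  have sq_le: "a\<^sup>2 * (norm g)\<^sup>2 \<le> \<beta> * A' * ((norm g)\<^sup>2 / l)"
  proof -
    have "a\<^sup>2 = \<beta> * A' * (\<beta> / l')"
      using l' by (simp add: a power_mult_distrib a'_sq[symmetric] power2_eq_square)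
    also have "\<dots> \<le> \<beta> * A' * (1 / l)"
      using \<beta>_bounds A'_pos by (intro mult_left_mono) auto
    finally have "a\<^sup>2 * (norm g)\<^sup>2 \<le> \<beta> * A' * (1 / l) * (norm g)\<^sup>2"
      by (intro mult_right_mono) auto
    then show ?thesis
      by simp
  qed
  have "\<beta> * A' * (inner g (y - z) + (norm g)\<^sup>2 / (2 * l)) \<le> 0"
    using MS_inner_le[OF l MS] \<beta>_bounds A'_pos by (simp add: g_def mult_nonneg_nonpos)
  then have MS_le: "\<beta> * (A' * inner g (y - z)) + \<beta> * A' * ((norm g)\<^sup>2 / l) / 2 \<le> 0"
    by (simp add: distrib_left mult.assoc)
  have "(norm (v - a *\<^sub>R g - p))\<^sup>2 = (norm (v - p))\<^sup>2 + 2 * (a * inner g (p - v)) + a\<^sup>2 * (norm g)\<^sup>2"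
    unfolding power2_norm_eq_inner
    by (simp add: inner_diff_left inner_diff_right inner_commute power2_eq_square algebra_simps)
  \<comment> \<open>The final combination is linear; stating it over fresh variables keeps the
    products opaque.\<close>
  moreover have "F - h + N' / 2 \<le> G - h + N / 2 + T + U / 2"
    if "N' = N + 2 * e + q" "F \<le> G" "e \<le> T" "q \<le> U" for F G N N' e q T U h :: real
    using that by linarith
  ultimately have "A1 * f xhat - A1 * f p + (norm (v - a *\<^sub>R g - p))\<^sup>2 / 2 \<le>
      ((1 - \<beta>) * A * f x + \<beta> * A' * f y) - A1 * f p + (norm (v - p))\<^sup>2 / 2
      + \<beta> * (a' * (f p - f y) + A * (f x - f y) + A' * inner g (y - z))
      + \<beta> * A' * ((norm g)\<^sup>2 / l) / 2"
    using xhat_le inner_le sq_le by blast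
  also have "\<dots> = A * (f x - f p) + (norm (v - p))\<^sup>2 / 2
      + (\<beta> * (A' * inner g (y - z)) + \<beta> * A' * ((norm g)\<^sup>2 / l) / 2)"
    unfolding A1 a A' by (simp add: algebra_simps)
  finally show ?thesis
    using MS_le by (simp add: g_def right_diff_distrib)
qed

section \<open>Invariants of a run\<close>

locale convex_aine = aine d f H \<delta> L3 \<xi> c1 c2 xstar x0 + convex_bdgm d f H \<delta> L3 \<xi>
  for d :: nat and f :: "fseq \<Rightarrow> real" and H :: "fseq \<Rightarrow> fseq \<Rightarrow> fseq" and \<delta> L3 \<xi> c1 c2 :: real
    and xstar x0 :: fseq +
  assumes c1: "0 < c1"
    and xstar: "xstar \<in> euclid d" "\<And>y. y \<in> euclid d \<Longrightarrow> f xstar \<le> f y"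
    and x0: "x0 \<in> euclid d"
    and bounded: "bounded (sublevel d f x0)"
begin

abbreviation R :: real where
  "R \<equiv> sublevel_radius d f xstar x0"

lemma sublevel_norm_le: "y \<in> sublevel d f x0 \<Longrightarrow> norm (y - xstar) \<le> R"
proof -
  assume y: "y \<in> sublevel d f x0"
  obtain B where B: "\<And>u. u \<in> sublevel d f x0 \<Longrightarrow> norm u \<le> B"
    using bounded unfolding bounded_iff by blast
  have "norm (u - xstar) \<le> B + norm xstar" if "u \<in> sublevel d f x0" for u
    using B[OF that] norm_triangle_ineq4[of u xstar] by linarith
  then have "bdd_above ((\<lambda>u. norm (u - xstar)) ` sublevel d f x0)"
    by (rule bdd_aboveI2)
  then show ?thesis
    unfolding sublevel_radius_def by (intro cSUP_upper y)
qed

lemma x0_in_sublevel: "x0 \<in> sublevel d f x0"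
  using x0 by (simp add: sublevel_def)

lemma R_nonneg: "0 \<le> R"
  using sublevel_norm_le[OF x0_in_sublevel] norm_ge_zero order_trans by blast

lemma returns_MS:
  assumes "z \<in> euclid d" "returns z y l"
  shows "y \<in> euclid d" "0 < l" "norm (grad d f y + l *\<^sub>R (y - z)) \<le> l / 2 * norm (y - z)"
proof -
  obtain ys n where "trace z ys n" "MS z (ys n)" "y = ys n" "l = lam z (ys n)"
    using assms(2) unfolding returns_def by blast
  then show "y \<in> euclid d" "0 < l" "norm (grad d f y + l *\<^sub>R (y - z)) \<le> l / 2 * norm (y - z)"
    using trace_in_trust_region[OF assms(1), of ys n n] trust_region_properties(2)[OF assms(1)]
      lam_pos by (auto simp: MS_def)
qed

lemma guess_scale_pos: "0 < guess_scale A"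
  using \<delta> by (simp add: guess_scale_def add_pos_nonneg)

text \<open>A guess is either fresh, hence at least \<open>c1 * guess_scale\<close>, or copied from
  the stored iteration. Iteration 0 is left out because its guess is the answer of the
  oracle.\<close>

lemma guess_positive:
  assumes reach: "reaches_query r t"
  shows "j \<le> t \<Longrightarrow> 0 < j \<Longrightarrow> stored r j \<le> j \<and> 0 < lams' r (stored r j) \<and> 0 < lams' r j"
proof (induction j)
  case (Suc j)
  have guess: "guess r (Suc j)"
    using reach Suc.prems unfolding reaches_query_def by (cases "Suc j < t") auto
  show ?case
  proof (cases "Suc j = 1 \<or> As r (Suc j) > 2 * As r (stored r j)")
    case True
    then have "stored r (Suc j) = Suc j" "c1 * guess_scale (As r (Suc j)) \<le> lams' r (Suc j)"
      using guess unfolding guess_def by (auto split: if_splits)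
    moreover have "0 < c1 * guess_scale (As r (Suc j))"
      using c1 guess_scale_pos by simp
    ultimately show ?thesis
      by simp
  next
    case False
    then have "stored r (Suc j) = stored r j" "lams' r (Suc j) = lams' r (stored r (Suc j))"
      using guess unfolding guess_def by auto
    then show ?thesis
      using Suc False by auto
  qed
qed simp

lemma query_in_euclid:
  assumes "query r t" "xs r t \<in> euclid d" "vs r t \<in> euclid d"
  shows "zs r t \<in> euclid d"
  using assms by (auto simp: query_def)

text \<open>Since \<open>xs r (Suc j)\<close> minimizes \<open>f\<close> over \<open>xhat\<close>
  and all earlier iterates, it stays in the sublevel set and does not increase the potential
  relative to \<open>xhat\<close>. The whole history is part of the invariant because the minimum
  ranges over it.\<close>

lemma run_invariant:
  assumes reach: "reaches_query r t"
  shows "j \<le> t \<Longrightarrow> (\<forall>i\<le>j. xs r i \<in> sublevel d f x0) \<and> vs r j \<in> euclid d \<and> 0 \<le> As r j \<and>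
    As r j * (f (xs r j) - f xstar) + (norm (vs r j - xstar))\<^sup>2 / 2 \<le> (norm (x0 - xstar))\<^sup>2 / 2"
proof (induction j)
  case 0
  then show ?case
    using reach x0 x0_in_sublevel by (simp add: reaches_query_def init_def)
next
  case (Suc j)
  then have j: "j < t" and IH: "\<And>i. i \<le> j \<Longrightarrow> xs r i \<in> sublevel d f x0" "vs r j \<in> euclid d" "0 \<le> As r j"
    "As r j * (f (xs r j) - f xstar) + (norm (vs r j - xstar))\<^sup>2 / 2 \<le> (norm (x0 - xstar))\<^sup>2 / 2"
    by auto
  have guess: "guess r j" and query: "query r j" and upd: "update r j"
    and ret: "returns (zs r j) (ys r j) (lams r j)"
    using reach j by (auto simp: reaches_query_def)
  have x: "xs r j \<in> euclid d"
    using IH by (simp add: sublevel_def)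
  have z: "zs r j \<in> euclid d"
    by (rule query_in_euclid[OF query x IH(2)])
  note answer = returns_MS[OF z ret]
  have l': "0 < lams' r j"
  proof (cases "j = 0")
    case True
    then show ?thesis
      using guess answer(2) by (simp add: guess_def)
  next
    case False
    then show ?thesis
      using guess_positive[OF reach, of j] j by simp
  qed
  define \<beta> xhat where "\<beta> = min 1 (lams' r j / lams r j)"
    "xhat = (((1 - \<beta>) * As r j) *\<^sub>R xs r j + (\<beta> * As' r (Suc j)) *\<^sub>R ys r j) /\<^sub>R As r (Suc j)"
  have upd': "as r (Suc j) = \<beta> * as' r (Suc j)" "As r (Suc j) = As r j + as r (Suc j)"
    "is_arg_min f (\<lambda>u. u \<in> insert xhat (xs r ` {..j})) (xs r (Suc j))"
    "vs r (Suc j) = vs r j - as r (Suc j) *\<^sub>R grad d f (ys r j)"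
    using upd unfolding update_def Let_def \<beta>_xhat_def by auto
  have q: "as' r (Suc j) = (1 + sqrt (1 + 4 * lams' r j * As r j)) / (2 * lams' r j)"
    "As' r (Suc j) = As r j + as' r (Suc j)"
    "zs r j = (As r j *\<^sub>R xs r j + as' r (Suc j) *\<^sub>R vs r j) /\<^sub>R As' r (Suc j)"
    using query unfolding query_def by auto
  have step: "As r (Suc j) * (f xhat - f xstar) + (norm (vs r (Suc j) - xstar))\<^sup>2 / 2 \<le>
      As r j * (f (xs r j) - f xstar) + (norm (vs r j - xstar))\<^sup>2 / 2"
    unfolding upd'(4)
    by (rule potential_step[OF x IH(2) answer(1) z xstar(1) IH(3) l' answer(2) q answer(3)
          \<beta>_xhat_def(1) upd'(1,2) \<beta>_xhat_def(2)])
  have A: "0 \<le> As r (Suc j)"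
    using upd' IH(3) l' answer(2) step_size_equation(1)[OF l' IH(3) q(1)] by (simp add: \<beta>_xhat_def)
  have xhat: "xhat \<in> euclid d"
    unfolding \<beta>_xhat_def using x answer by auto
  have le: "f (xs r (Suc j)) \<le> f xhat" "f (xs r (Suc j)) \<le> f (xs r j)"
    and "xs r (Suc j) \<in> insert xhat (xs r ` {..j})"
    using upd'(3) by (auto simp: is_arg_min_linorder)
  then have "xs r (Suc j) \<in> sublevel d f x0"
    using IH(1)[of j] xhat IH(1) by (fastforce simp: sublevel_def)
  moreover have "As r (Suc j) * (f (xs r (Suc j)) - f xstar) \<le> As r (Suc j) * (f xhat - f xstar)"
    using A le(1) by (intro mult_left_mono) auto
  ultimately show ?case
    using IH upd'(4) answer(1) A step by (auto simp: le_Suc_eq)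
qed

lemma query_point_near:
  assumes "query_point z"
  shows "z \<in> euclid d" "norm (z - xstar) \<le> R"
proof -
  obtain r t where reach: "reaches_query r t" and z: "z = zs r t"
    using assms unfolding query_point_def by blast
  have "z \<in> euclid d \<and> norm (z - xstar) \<le> R"
  proof (cases "t = 0")
    case True
    then have "z = x0"
      using reach z by (simp add: reaches_query_def init_def)
    then show ?thesis
      using x0 sublevel_norm_le[OF x0_in_sublevel] by simp
  next
    case False
    then have query: "query r t" and l': "0 < lams' r t"
      using reach guess_positive[OF reach, of t] by (auto simp: reaches_query_def)
    have inv: "xs r t \<in> sublevel d f x0" "vs r t \<in> euclid d" "0 \<le> As r t"
      "As r t * (f (xs r t) - f xstar) + (norm (vs r t - xstar))\<^sup>2 / 2 \<le> (norm (x0 - xstar))\<^sup>2 / 2"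
      using run_invariant[OF reach, of t] by auto
    have x: "xs r t \<in> euclid d" "norm (xs r t - xstar) \<le> R"
      using inv(1) sublevel_norm_le by (auto simp: sublevel_def)
    have "0 \<le> As r t * (f (xs r t) - f xstar)"
      using inv(3) xstar(2)[OF x(1)] by simp
    then have "(norm (vs r t - xstar))\<^sup>2 \<le> (norm (x0 - xstar))\<^sup>2"
      using inv(4) by linarith
    then have v: "norm (vs r t - xstar) \<le> R"
      using sublevel_norm_le[OF x0_in_sublevel]
        power2_le_imp_le[of "norm (vs r t - xstar)" "norm (x0 - xstar)"] by simp
    define A a where "A = As r t" "a = as' r (Suc t)"
    note Aa = this
    have a: "0 < a" "0 \<le> A"
      using step_size_equation(1)[OF l' inv(3)] query inv(3) by (auto simp: query_def Aa)
    define s where "s = a / (A + a)"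
    have s: "0 \<le> s" "s \<le> 1" "1 - s = A / (A + a)"
      using a by (auto simp: s_def field_simps)
    have "z = (1 - s) *\<^sub>R xs r t + s *\<^sub>R vs r t"
    proof -
      have "z = (A *\<^sub>R xs r t + a *\<^sub>R vs r t) /\<^sub>R (A + a)"
        using query by (simp add: query_def z Aa)
      then show ?thesis
        unfolding s(3) by (simp add: s_def scaleR_add_right divide_inverse mult.commute)
    qed
    then have "z \<in> cball xstar R"
      using convexD_alt[OF convex_cball[of xstar R] _ _ s(1,2), of "xs r t" "vs r t"] x(2) v
      by (simp add: dist_norm norm_minus_commute)
    then show ?thesis
      using query_in_euclid[OF query x(1) inv(2)] z by (simp add: dist_norm norm_minus_commute)
  qed
  then show "z \<in> euclid d" "norm (z - xstar) \<le> R"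
    by auto
qed

lemma norm_grad_le:
  assumes z: "z \<in> euclid d" and D: "norm (z - x0) \<le> D"
    and B: "B = opnorm2 d (hess d f x0) + opnorm3 d (third_deriv d f x0) * D + L3 / 2 * D\<^sup>2"
  shows "norm (grad d f z) \<le> norm (grad d f x0) + B * D"
proof -
  have B_nonneg: "0 \<le> B"
    unfolding B using L3_pos order_trans[OF norm_ge_zero D]
    by (intro add_nonneg_nonneg mult_nonneg_nonneg opnorm2_nonneg opnorm3_nonneg linear_hess
        trilinear_third_deriv x0) auto
  have "norm (grad d f z - grad d f x0) \<le> B * norm (z - x0)"
  proof (rule grad_Lipschitz[OF x0 z])
    fix p u w assume p: "p \<in> closed_segment x0 z" and uw: "u \<in> euclid d" "w \<in> euclid d"
    have "closed_segment x0 z \<subseteq> euclid d \<inter> cball x0 D"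
      using x0 z D order_trans[OF norm_ge_zero D]
      by (intro closed_segment_subset convex_Int convex_cball
          subspace_imp_convex[OF subspace_euclid]) (auto simp: dist_norm norm_minus_commute)
    then show "\<bar>inner (hess d f p u) w\<bar> \<le> B * norm u * norm w"
      unfolding B using p uw x0 by (intro hess_le) (auto simp: dist_norm norm_minus_commute)
  qed
  also have "\<dots> \<le> B * D"
    using B_nonneg D by (rule mult_left_mono[rotated])
  finally show ?thesis
    using norm_triangle_ineq[of "grad d f z - grad d f x0" "grad d f x0"] by simp
qed

section \<open>The polylogarithmic bound\<close>

text \<open>\<open>\<delta>\<close> may be much larger than \<open>Q\<close>, which dominates \<open>1 / \<delta>\<close> only; therefore the constants \<open>S\<close> and
  \<open>M'\<close> are bounded by \<open>\<delta>\<close> times a power of \<open>Q\<close>.\<close>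

lemma iteration_count:
  assumes query: "query_point z" and trace: "trace z y n" and k: "k \<le> n" and not_MS: "\<not> MS z (y k)"
    and Q: "20 \<le> Q" "\<xi> + \<xi>\<^sup>2 \<le> Q" "1 / (\<xi> - 1) \<le> Q" "(\<xi>\<^sup>2 - 1) / \<xi> \<le> Q" "\<xi> / (\<xi>\<^sup>2 - 1) \<le> Q"
    and args: "1 / \<delta> \<le> Q" "L3 \<le> Q" "R \<le> Q" "norm (grad d f x0) \<le> Q"
      "opnorm2 d (hess d f x0) \<le> Q" "opnorm3 d (third_deriv d f x0) \<le> Q"
  shows "1 < Q ^ 198 * rate ^ k"
proof -
  have z: "z \<in> euclid d" and z_near: "norm (z - xstar) \<le> R"
    using query_point_near[OF query] by auto
  have "norm (z - x0) \<le> norm (z - xstar) + norm (xstar - x0)"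
    using norm_triangle_ineq[of "z - xstar" "xstar - x0"] by simp
  then have z_x0: "norm (z - x0) \<le> 2 * R"
    using z_near sublevel_norm_le[OF x0_in_sublevel] by (simp add: norm_minus_commute)
  have nz: "grad d f z \<noteq> 0"
  proof
    assume "grad d f z = 0"
    then have "MS z (y 0)"
      using trace by (simp add: trace_def MS_def)
    then show False
      using trace k not_MS by (cases k) (auto simp: trace_def)
  qed
  define h where
    "h D = opnorm2 d (hess d f x0) + opnorm3 d (third_deriv d f x0) * D + L3 / 2 * D\<^sup>2" for D
  define op2 op3 where "op2 = opnorm2 d (hess d f x0)" "op3 = opnorm3 d (third_deriv d f x0)"
  note op = this
  have op_nonneg: "0 \<le> op2" "0 \<le> op3"
    unfolding op by (intro opnorm2_nonneg opnorm3_nonneg linear_hess trilinear_third_deriv x0)+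
  have Q1: "1 \<le> Q" and Q0: "0 \<le> Q"
    using Q(1) by auto
  \<comment> \<open>Every numerical constant up to 20 is absorbed at the price of one more factor
    \<open>Q\<close>.\<close>
  have pow: "c * Q ^ m \<le> Q ^ n" if "Suc m \<le> n" "c \<le> 20" for c m n
  proof -
    have "c * Q ^ m \<le> Q * Q ^ m"
      using that Q by (intro mult_right_mono) auto
    also have "\<dots> \<le> Q ^ n"
      using power_increasing[OF that(1) Q1] by simp
    finally show ?thesis .
  qed
  have mul: "a * b \<le> Q ^ m" if "a \<le> Q ^ i" "b \<le> Q ^ j" "0 \<le> b" "i + j = m" for a b i j m
  proof -
    have "a * b \<le> Q ^ i * Q ^ j"
      using that Q0 by (intro mult_mono) auto
    then show ?thesis
      by (simp add: power_add flip: that(4))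
  qed
  have h_nonneg: "0 \<le> h D" if "0 \<le> D" for D
    unfolding h_def op[symmetric] using op_nonneg L3_pos that by simp
  have h_le: "h D \<le> Q ^ (2 * m + 2)" if D: "0 \<le> D" "D \<le> Q ^ m" "1 \<le> m" for D m
  proof -
    have D2: "D\<^sup>2 \<le> Q ^ (2 * m)"
      using power_mono[OF D(2,1), of 2] by (simp add: power_mult[symmetric] mult.commute)
    have "op3 * D \<le> Q ^ (m + 1)"
      using args D op by (intro mul[of _ 1 _ m]) auto
    moreover have "L3 * D\<^sup>2 \<le> Q ^ (2 * m + 1)"
      using args D2 by (intro mul[of _ 1 _ "2 * m"]) auto
    moreover have "Q ^ 1 \<le> Q ^ (2 * m + 1)" "Q ^ (m + 1) \<le> Q ^ (2 * m + 1)"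
      using Q1 by (intro power_increasing; simp)+
    moreover have "op2 \<le> Q ^ 1"
      using args op by simp
    moreover have "0 \<le> L3 * D\<^sup>2"
      using L3_pos by simp
    ultimately have "h D \<le> 3 * Q ^ (2 * m + 1)"
      unfolding h_def op[symmetric] by linarith
    also have "\<dots> \<le> Q ^ (2 * m + 2)"
      by (rule pow) auto
    finally show ?thesis .
  qed
  have R2: "0 \<le> 2 * R" "2 * R \<le> Q ^ 2"
    using R_nonneg args Q pow[of 1 2 2] by auto
  \<comment> \<open>The exponent 11 is 9 for the gradient at \<open>z\<close> plus 2 for the inverse
    of \<open>lam_min\<close>, which is \<open>\<kappa> * \<delta>\<close> with both factors at
    least \<open>1 / Q\<close>.\<close>
  define B r0 where "B = h (2 * R)" "r0 = Q ^ 11"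
  have B: "0 \<le> B" "B \<le> Q ^ 6"
    using h_nonneg[OF R2(1)] h_le[OF R2] by (auto simp: B_r0_def)
  have "norm (grad d f z) \<le> norm (grad d f x0) + B * (2 * R)"
    by (rule norm_grad_le[OF z z_x0]) (simp add: B_r0_def h_def)
  also have "\<dots> \<le> Q ^ 1 + Q ^ 8"
    using args mul[OF B(2) R2(2,1), of 8] by simp
  also have "\<dots> \<le> 2 * Q ^ 8"
    using power_increasing[of 1 8 Q] Q1 by simp
  also have "\<dots> \<le> Q ^ 9"
    by (rule pow) auto
  finally have grad_z: "norm (grad d f z) \<le> Q ^ 9" .
  define \<kappa> where "\<kappa> = (\<xi>\<^sup>2 - 1) / \<xi>"
  have \<kappa>: "0 < \<kappa>" "\<kappa> \<le> Q" "1 \<le> \<kappa> * Q" and lam_min: "lam_min = \<kappa> * \<delta>"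
    using \<xi> \<xi>_square Q by (auto simp: \<kappa>_def lam_min_def field_simps)
  have \<delta>Q: "1 \<le> \<delta> * Q"
    using args(1) \<delta> by (simp add: field_simps)
  have \<xi>Q: "1 \<le> (\<xi> - 1) * Q"
    using Q(3) \<xi> by (simp add: field_simps)
  have \<delta>_mult: "a \<le> \<delta> * Q ^ Suc m" if "a \<le> Q ^ m" for a m
  proof -
    have "Q ^ m * 1 \<le> Q ^ m * (\<delta> * Q)"
      using \<delta>Q Q0 by (intro mult_left_mono) auto
    then show ?thesis
      using that by (simp add: mult_ac)
  qed
  have \<delta>_pow: "\<delta> * Q ^ m \<le> \<delta> * Q ^ n" if "m \<le> n" for m n
    using power_increasing[OF that Q1] \<delta> by simp
  define S where "S = B + (1 + \<xi>) * \<delta> + (\<xi> + \<xi>\<^sup>2) * L3 / 6 * r0\<^sup>2"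
  have S: "0 \<le> S" "S \<le> \<delta> * Q ^ 26"
  proof -
    show "0 \<le> S"
      using B \<xi> \<delta> L3_pos by (simp add: S_def)
    have "(\<xi> + \<xi>\<^sup>2) * (L3 * r0\<^sup>2) \<le> Q ^ 24"
      using Q args L3_pos by (intro mul[of _ 1 _ 23] mul[of _ 1 _ 22])
        (auto simp: B_r0_def simp flip: power_mult)
    then have "(\<xi> + \<xi>\<^sup>2) * L3 * r0\<^sup>2 \<le> \<delta> * Q ^ 25"
      using \<delta>_mult[of _ 24] by (simp add: mult.assoc)
    moreover have "0 \<le> (\<xi> + \<xi>\<^sup>2) * L3 * r0\<^sup>2"
      using \<xi> L3_pos by simp
    moreover have "B \<le> \<delta> * Q ^ 25"
      using \<delta>_mult[OF B(2)] \<delta>_pow[of "Suc 6" 25] by simp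
    moreover have "(1 + \<xi>) * \<delta> \<le> \<delta> * Q ^ 25"
    proof -
      have "1 + \<xi> \<le> Q"
        using Q(2) \<xi>_square by linarith
      then have "(1 + \<xi>) * \<delta> \<le> Q * \<delta>"
        using \<delta> by (intro mult_right_mono) auto
      then show ?thesis
        using \<delta>_pow[of 1 25] by (simp add: mult.commute)
    qed
    moreover have "(\<xi> + \<xi>\<^sup>2) * L3 / 6 * r0\<^sup>2 = (\<xi> + \<xi>\<^sup>2) * L3 * r0\<^sup>2 / 6"
      by simp
    ultimately have "S \<le> 3 * (\<delta> * Q ^ 25)"
      unfolding S_def by linarith
    also have "\<dots> \<le> \<delta> * Q ^ 26"
      using pow[of 25 26 3] \<delta> by simp
    finally show "S \<le> \<delta> * Q ^ 26" .
  qed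
  define D where "D = r0 * (2 + S / ((\<xi> - 1) * \<delta>))"
  have D: "0 \<le> D" "D \<le> Q ^ 39"
  proof -
    show "0 \<le> D"
      using S \<xi> \<delta> Q0 by (simp add: D_def B_r0_def)
    have "S \<le> Q ^ 27 * ((\<xi> - 1) * \<delta>)"
    proof -
      have "\<delta> * Q ^ 26 * 1 \<le> \<delta> * Q ^ 26 * ((\<xi> - 1) * Q)"
        using \<xi>Q \<delta> Q0 by (intro mult_left_mono) auto
      also have "\<dots> = Q ^ Suc 26 * ((\<xi> - 1) * \<delta>)"
        by (simp only: power_Suc mult_ac)
      finally show ?thesis
        using S by simp
    qed
    then have "S / ((\<xi> - 1) * \<delta>) \<le> Q ^ 27"
      using \<xi> \<delta> by (simp add: pos_divide_le_eq)
    then have "2 + S / ((\<xi> - 1) * \<delta>) \<le> 3 * Q ^ 27"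
      using one_le_power[OF Q1, of 27] by linarith
    also have "\<dots> \<le> Q ^ 28"
      by (rule pow) auto
    finally show "D \<le> Q ^ 39"
      unfolding D_def B_r0_def using S \<xi> \<delta> by (intro mul[of _ 11 _ 28]) auto
  qed
  have D': "0 \<le> 2 * R + D" "2 * R + D \<le> Q ^ 40"
  proof -
    have "2 * R + D \<le> 2 * Q ^ 39"
      using R2 D power_increasing[of 2 39 Q] Q1 by simp
    also have "\<dots> \<le> Q ^ 40"
      by (rule pow) auto
    finally show "2 * R + D \<le> Q ^ 40" .
  qed (use R2 D in simp)
  \<comment> \<open>A point within \<open>D\<close> of \<open>z\<close> lies within
    \<open>2 * R + D\<close> of \<open>x0\<close>, so the Hessian bound centred at \<open>x0\<close>
    applies there.\<close>
  define M M' where "M = h (2 * R + D)" "M' = M + lam_min + (1 + \<xi>) * \<xi> * L3 / 2 * D\<^sup>2"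
  note M_defs = this
  have M: "0 \<le> M" "M \<le> Q ^ 82"
    using h_nonneg[OF D'(1)] h_le[OF D'] by (auto simp: M_defs)
  have M': "0 \<le> M'" "M' \<le> \<delta> * Q ^ 84"
  proof -
    show "0 \<le> M'"
      using M lam_min_pos \<xi> L3_pos by (simp add: M_defs(2))
    have "D\<^sup>2 \<le> Q ^ 78"
      using power_mono[OF D(2,1), of 2] by (simp flip: power_mult)
    then have "(\<xi> + \<xi>\<^sup>2) * (L3 * D\<^sup>2) \<le> Q ^ 80"
      using Q args L3_pos by (intro mul[of _ 1 _ 79] mul[of _ 1 _ 78]) auto
    then have "(\<xi> + \<xi>\<^sup>2) * (L3 * D\<^sup>2) \<le> \<delta> * Q ^ 83"
      using \<delta>_mult[of _ 80] \<delta>_pow[of "Suc 80" 83] by fastforce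
    moreover have "(1 + \<xi>) * \<xi> * L3 / 2 * D\<^sup>2 = (\<xi> + \<xi>\<^sup>2) * (L3 * D\<^sup>2) / 2"
      by (simp add: power2_eq_square algebra_simps)
    moreover have "0 \<le> (\<xi> + \<xi>\<^sup>2) * (L3 * D\<^sup>2)"
      using \<xi> L3_pos by simp
    moreover have "M \<le> \<delta> * Q ^ 83"
      using \<delta>_mult[OF M(2)] by simp
    moreover have "lam_min \<le> \<delta> * Q ^ 83"
    proof -
      have "\<kappa> * \<delta> \<le> Q * \<delta>"
        using \<kappa> \<delta> by (intro mult_right_mono) auto
      then show ?thesis
        using \<delta>_pow[of 1 83] by (simp add: lam_min mult.commute)
    qed
    ultimately have "M' \<le> 3 * (\<delta> * Q ^ 83)"
      unfolding M_defs(2) by linarith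
    also have "\<dots> \<le> \<delta> * Q ^ 84"
      using pow[of 83 84 3] \<delta> by simp
    finally show "M' \<le> \<delta> * Q ^ 84" .
  qed
  have "lam_min\<^sup>2 * ((\<xi> - 1) * \<delta>) < 16 * S * M'\<^sup>2 * rate ^ k"
  proof (rule not_MS_imp_rate_power[OF z trace k not_MS nz B(1) _ _ S_def D_def M(1) _ M_defs(2)])
    show "inner (hess d f z u) u \<le> B * (norm u)\<^sup>2" if "u \<in> euclid d" for u
      using hess_le[OF x0 z that that z_x0] by (simp add: B_r0_def h_def power2_eq_square mult.assoc)
    have "Q ^ 9 * 1 * 1 \<le> Q ^ 9 * (\<kappa> * Q) * (\<delta> * Q)"
      using \<kappa> \<delta>Q Q0 by (intro mult_mono) auto
    also have "\<dots> = lam_min * r0"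
      by (simp add: lam_min B_r0_def mult_ac flip: power_Suc)
    finally show "norm (grad d f z) \<le> lam_min * r0"
      using grad_z by simp
    fix p u w assume p: "p \<in> euclid d" "norm (p - z) \<le> D" and uw: "u \<in> euclid d" "w \<in> euclid d"
    have "norm (p - x0) \<le> 2 * R + D"
      using norm_triangle_ineq[of "p - z" "z - x0"] p z_x0 by simp
    then show "\<bar>inner (hess d f p u) w\<bar> \<le> M * norm u * norm w"
      using hess_le[OF x0 p(1) uw] by (simp add: M_defs(1) h_def)
  qed
  also have "16 * S * M'\<^sup>2 * rate ^ k \<le> 16 * (\<delta> * Q ^ 26) * (\<delta> * Q ^ 84)\<^sup>2 * rate ^ k"
    using S M' rate_bounds Q0 \<delta> by (intro mult_right_mono mult_mono power_mono) auto
  also have "\<dots> = \<delta> ^ 3 * (16 * Q ^ 194 * rate ^ k)"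
    by (simp add: power_mult_distrib power3_eq_cube power2_eq_square mult_ac flip: power_add power_mult)
  \<comment> \<open>Both sides are now \<delta> cubed times a factor free of \<delta>, so the
    possibly huge \<delta> cancels.\<close>
  finally have "\<delta> ^ 3 * (\<kappa>\<^sup>2 * (\<xi> - 1)) < \<delta> ^ 3 * (16 * Q ^ 194 * rate ^ k)"
    by (simp add: lam_min power_mult_distrib power3_eq_cube power2_eq_square mult_ac)
  then have "\<kappa>\<^sup>2 * (\<xi> - 1) < 16 * Q ^ 194 * rate ^ k"
    using \<delta> by simp
  \<comment> \<open>The left factor is at least \<open>1 / Q ^ 3\<close>. The exponent 198 is thus
    26 from \<open>S\<close>, twice 84 from \<open>M'\<close>, 3 from here and 1 for the constant
    16.\<close>
  then have "\<kappa>\<^sup>2 * (\<xi> - 1) * Q ^ 3 < 16 * Q ^ 194 * rate ^ k * Q ^ 3"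
    using Q1 by (intro mult_strict_right_mono) auto
  also have "\<dots> = 16 * Q ^ 197 * rate ^ k"
    by (simp add: mult_ac flip: power_add)
  also have "\<dots> \<le> Q ^ 198 * rate ^ k"
    using pow[of 197 198 16] rate_bounds by (intro mult_right_mono) auto
  finally have "\<kappa>\<^sup>2 * (\<xi> - 1) * Q ^ 3 < Q ^ 198 * rate ^ k" .
  moreover have "1 \<le> (\<kappa> * Q) * (\<kappa> * Q) * ((\<xi> - 1) * Q)"
    using \<kappa>(3) \<xi>Q by (smt (verit) mult_le_cancel_left1 mult_le_cancel_left2)
  then have "1 \<le> \<kappa>\<^sup>2 * (\<xi> - 1) * Q ^ 3"
    by (simp add: power2_eq_square power3_eq_cube mult_ac)
  ultimately show ?thesis
    by linarith
qed

end

text \<open>The exponential is the product of all factors \<open>1 + a\<close>, each at least 1. It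
  serves as one quantity dominating all arguments whose logarithm is the sum in
  \<open>polylog\<close>.\<close>

lemma le_exp_sum_ln:
  fixes a :: real
  assumes "a \<in> set args" "\<forall>a\<in>set args. 0 \<le> a"
  shows "a \<le> exp (\<Sum>a\<leftarrow>args. ln (1 + a))"
  using assms
proof (induction args)
  case (Cons b args)
  have nonneg: "0 \<le> (\<Sum>a\<leftarrow>args. ln (1 + a))"
    using Cons.prems by (intro sum_list_nonneg) auto
  have b: "0 \<le> b"
    using Cons.prems by simp
  show ?case
  proof (cases "a = b")
    case True
    have "a \<le> exp (ln (1 + a))"
      using b True by simp
    also have "\<dots> \<le> exp (\<Sum>a\<leftarrow>b # args. ln (1 + a))"
      using nonneg True by simp
    finally show ?thesis .
  next
    case False
    then have "a \<le> exp (\<Sum>a\<leftarrow>args. ln (1 + a))"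
      using Cons by simp
    also have "\<dots> \<le> exp (\<Sum>a\<leftarrow>b # args. ln (1 + a))"
      using b by simp
    finally show ?thesis .
  qed
qed simp

lemma power_rate_bound:
  fixes Q \<rho> :: real
  assumes "1 < Q ^ m * \<rho> ^ k" "0 < Q" "0 < \<rho>" "\<rho> < 1"
  shows "k < m * ln Q / ln (1 / \<rho>)"
proof -
  have "0 < ln (Q ^ m * \<rho> ^ k)"
    using assms(1) by simp
  also have "\<dots> = m * ln Q + k * ln \<rho>"
    using assms by (simp add: ln_mult ln_realpow)
  finally have "k * ln (1 / \<rho>) < m * ln Q"
    using assms by (simp add: ln_div)
  moreover have "0 < ln (1 / \<rho>)"
    using assms by simp
  ultimately show ?thesis
    by (simp add: pos_less_divide_eq)
qed

theorem theorem4p1: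
  fixes \<xi> c1 c2 :: real
  assumes "1 < \<xi>" and "0 < c1" and "c1 \<le> c2"
  shows "\<exists>K. polylog K \<and>
    (\<forall>(d::nat) (f :: fseq \<Rightarrow> real) (H :: fseq \<Rightarrow> fseq \<Rightarrow> fseq)
      (\<delta>::real) (L3::real) (\<epsilon>::real) (xstar::fseq) (x0::fseq) (z::fseq).
       convex_on (euclid d) f \<and> C3 d f \<and>
       0 < L3 \<and> third_deriv_lipschitz d f L3 \<and>
       0 < \<delta> \<and> hessian_estimator d f \<delta> H \<and>
       0 < \<epsilon> \<and>
       xstar \<in> euclid d \<and> (\<forall>y\<in>euclid d. f xstar \<le> f y) \<and>
       x0 \<in> euclid d \<and> bounded (sublevel d f x0) \<and>
       aine.query_point d f H \<delta> L3 \<xi> c1 c2 xstar x0 z \<and>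
       norm (grad d f z) \<ge> \<epsilon> / sublevel_radius d f xstar x0
       \<longrightarrow>
       bdgm.terminates_within d f H \<delta> L3 \<xi> z
         (K [1 / \<delta>, 1 / \<epsilon>, L3, sublevel_radius d f xstar x0, norm (grad d f x0),
             opnorm2 d (hess d f x0), opnorm3 d (third_deriv d f x0)]))"
proof -
  \<comment> \<open>The part of \<open>Q\<close> that depends on \<xi> only: a sum of nonnegative
    terms, so it dominates each of them.\<close>
  define X where "X = 20 + (\<xi> + \<xi>\<^sup>2) + 1 / (\<xi> - 1) + (\<xi>\<^sup>2 - 1) / \<xi> + \<xi> / (\<xi>\<^sup>2 - 1)"
  \<comment> \<open>The contraction factor is a function of \<xi> alone and can be named before the
    other data are fixed.\<close>
  define \<rho> where "\<rho> = convex_bdgm.rate \<xi>"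
  define C where "C = 1 + 198 * (1 + ln X) / ln (1 / \<rho>)"
  define \<Lambda> where "\<Lambda> args = (\<Sum>a\<leftarrow>args. ln (1 + a))" for args :: "real list"
  define K where "K args = C * (1 + \<Lambda> args) ^ 1" for args
  have "1 < \<xi>\<^sup>2"
    using assms(1) by simp
  then have X_summands: "0 \<le> \<xi> + \<xi>\<^sup>2" "0 \<le> 1 / (\<xi> - 1)" "0 \<le> (\<xi>\<^sup>2 - 1) / \<xi>" "0 \<le> \<xi> / (\<xi>\<^sup>2 - 1)"
    using assms(1) by auto
  then have X: "20 \<le> X" "\<xi> + \<xi>\<^sup>2 \<le> X" "1 / (\<xi> - 1) \<le> X" "(\<xi>\<^sup>2 - 1) / \<xi> \<le> X" "\<xi> / (\<xi>\<^sup>2 - 1) \<le> X"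
    unfolding X_def by linarith+
  show ?thesis
  proof (intro exI[of _ K] conjI allI impI)
    show "polylog K"
      unfolding polylog_def K_def \<Lambda>_def by (intro exI[of _ C] exI[of _ 1]) auto
  next
    fix d f H \<delta> L3 \<epsilon> xstar x0 z
    assume asm: "convex_on (euclid d) f \<and> C3 d f \<and>
       0 < L3 \<and> third_deriv_lipschitz d f L3 \<and>
       0 < \<delta> \<and> hessian_estimator d f \<delta> H \<and>
       0 < \<epsilon> \<and>
       xstar \<in> euclid d \<and> (\<forall>y\<in>euclid d. f xstar \<le> f y) \<and>
       x0 \<in> euclid d \<and> bounded (sublevel d f x0) \<and>
       aine.query_point d f H \<delta> L3 \<xi> c1 c2 xstar x0 z \<and>
       norm (grad d f z) \<ge> \<epsilon> / sublevel_radius d f xstar x0"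
    interpret convex_aine d f H \<delta> L3 \<xi> c1 c2 xstar x0
      by unfold_locales (use asm assms in auto)
    have query: "query_point z"
      using asm by blast
    have z: "z \<in> euclid d"
      by (rule query_point_near[OF query])
    define args where "args = [1 / \<delta>, 1 / \<epsilon>, L3, R, norm (grad d f x0),
      opnorm2 d (hess d f x0), opnorm3 d (third_deriv d f x0)]"
    have nonneg: "\<forall>a\<in>set args. 0 \<le> a"
      using asm R_nonneg opnorm2_nonneg[OF linear_hess[OF x0]]
        opnorm3_nonneg[OF trilinear_third_deriv[OF x0]] by (auto simp: args_def)
    have \<Lambda>: "0 \<le> \<Lambda> args"
      unfolding \<Lambda>_def using nonneg by (intro sum_list_nonneg) auto
    define Q where "Q = X * exp (\<Lambda> args)"
    have X_le: "X \<le> Q"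
      using X(1) \<Lambda> by (simp add: Q_def)
    have args_le: "a \<le> Q" if "a \<in> set args" for a
    proof -
      have "a \<le> exp (\<Lambda> args)"
        unfolding \<Lambda>_def using that nonneg by (rule le_exp_sum_ln)
      also have "\<dots> \<le> Q"
        using X(1) by (simp add: Q_def)
      finally show ?thesis .
    qed
    have rate: "\<rho> = rate"
      by (simp add: \<rho>_def)
    have ln_rate: "0 < ln (1 / \<rho>)"
      using rate_bounds unfolding rate by simp
    have "real n \<le> K args" if trace: "trace z y n" for y n
    proof (cases n)
      case 0
      have "0 \<le> C"
        unfolding C_def using ln_rate X(1) by (intro add_nonneg_nonneg divide_nonneg_pos) auto
      then show ?thesis
        using 0 \<Lambda> by (simp add: K_def)
    next
      \<comment> \<open>A trace with \<open>n\<close> iterations certifies a violation of MS only up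
        to index \<open>n - 1\<close>, so the count is applied to \<open>k\<close>; the leading 1 in
        \<open>C\<close> accounts for the last iteration.\<close>
      case (Suc k)
      then have k: "k \<le> n" "\<not> MS z (y k)"
        using trace by (auto simp: trace_def)
      have "1 < Q ^ 198 * rate ^ k"
        using X X_le args_le by (intro iteration_count[OF query trace k]) (auto simp: args_def)
      then have "real k < 198 * ln Q / ln (1 / \<rho>)"
        using power_rate_bound[of Q 198 rate k] rate_bounds X(1) X_le by (simp add: rate)
      also have "ln Q = ln X + \<Lambda> args"
        using X(1) by (simp add: Q_def ln_mult)
      also have "198 * (ln X + \<Lambda> args) / ln (1 / \<rho>) \<le> 198 * ((1 + ln X) * (1 + \<Lambda> args)) / ln (1 / \<rho>)"
        using X(1) \<Lambda> ln_rate by (intro divide_right_mono mult_left_mono) (auto simp: algebra_simps)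
      also have "\<dots> = 198 * (1 + ln X) / ln (1 / \<rho>) * (1 + \<Lambda> args)"
        by simp
      finally have "real n \<le> 1 + 198 * (1 + ln X) / ln (1 / \<rho>) * (1 + \<Lambda> args)"
        using Suc by linarith
      also have "\<dots> \<le> K args"
        using \<Lambda> by (simp add: K_def C_def algebra_simps)
      finally show ?thesis .
    qed
    then show "terminates_within z (K [1 / \<delta>, 1 / \<epsilon>, L3, R, norm (grad d f x0),
        opnorm2 d (hess d f x0), opnorm3 d (third_deriv d f x0)])"
      unfolding terminates_within_def args_def using step_exists[OF z] by blast
  qed
qed

end
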